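(* Let $(V(u),\,u\in\mathcal T)$ be a branching random walk with reproduction point process $\aleph$ and intensity $\mu$ satisfying $\mu(\mathbb R)>1$, and suppose that (H1) or (H2) (defined in the context) holds. Then $$M:=\sup_{\xi\in\partial\mathcal T}\ \sum_{n\ge 0} e^{-V(\xi_n)}<\infty\qquad \mathbb P^*\text{-a.s.}$$ Moreover, $\mathbb P^*$-a.s., $$\Xi_b:=\sup_{\xi\in\partial\mathcal T}\ \sum_{n\ge 0}\bigl(1+|V(\xi_n)|\bigr)^{-b}<\infty$$ for all $b>2$ under (H1), and for all $b>3$ under (H2).
   Context: Branching random walk: $\aleph$ is a point process on $\mathbb R$. A single particle $\varnothing$ (the root) starts at $V(\varnothing)=0$ in generation $0$. Its children, together with their positions, form the point process $\aleph=\sum_{|u|=1}\delta_{V(u)}$. Recursively, each particle $u$ of generation $n$ gives birth in generation $n+1$ to children whose positions form an independent copy of $\aleph$ shifted by $V(u)$. $\mathcal T$ is the resulting genealogical (Ulam–Harris) tree, $|u|$ is the generation of $u$ and $V(u)\in\mathbb R$ its position. Let $\mu(\mathrm dx):=\mathbb E[\aleph(\mathrm dx)]$, and assume $\mu(\mathbb R)>1$ (supercriticality; $\mu(\mathbb R)=\infty$ is not excluded). Let $\mathcal S$ be the event that $\mathcal T$ is infinite (non-extinction) and $\mathbb P^*:=\mathbb P(\cdot\mid\mathcal S)$. Put $\varphi(t):=\log\int_{\mathbb R}e^{-tx}\mu(\mathrm dx)\in(-\infty,\infty]$ for $t\in\mathbb R$. A ray $\xi$ of $\mathcal T$ is either the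 finite shortest path from the root to a leaf of $\mathcal T$, or an infinite path $\xi=(\xi_0=\varnothing,\xi_1,\xi_2,\dots)$ with $\xi_n$ the parent of $\xi_{n+1}$ for all $n$. $\partial\mathcal T$ is the set of all rays (finite or infinite); for a finite ray, sums over $n$ run only over the vertices of the ray. The integral $\int_{\mathbb R}xe^{-t^*x}\mu(\mathrm dx)$ is called well-defined if at least one of $\int_{(-\infty,0)}|x|e^{-t^*x}\mu(\mathrm dx)$, $\int_{(0,\infty)}xe^{-t^*x}\mu(\mathrm dx)$ is finite. (H1): there exists $t>0$ with $\varphi(t)=0$; $t^*$ denotes the minimal such $t$; the integral $\int_{\mathbb R}xe^{-t^*x}\mu(\mathrm dx)$ is well-defined and nonzero. (H2): there exists $t^*>0$ with $\varphi(t^* )=0$, and $\varphi(t)\in[0,\infty]$ for all $t>0$; the integral $\int_{\mathbb R}xe^{-t^*x}\mu(\mathrm dx)$ is well-defined and equal to $0$, and $\int_{\mathbb R}x^2e^{-t^*x}\mu(\mathrm dx)\in(0,\infty)$. *)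

theory Defs
  imports "HOL-Probability.Probability"
begin

text \<open>A configuration \<open>(n, x)\<close> encodes the finite or countably infinite point measure
  \<open>\<Sum>i<n. \<delta>\<^sub>x\<^sub>i\<close> on the reals by an enumeration of its atoms, repeated according to
  multiplicity; the entries \<open>x i\<close> with \<open>i \<ge> n\<close> are irrelevant.\<close>

type_synonym config = "enat \<times> (nat \<Rightarrow> real)"

definition config_space :: "config measure" where
  "config_space = count_space UNIV \<Otimes>\<^sub>M (\<Pi>\<^sub>M i\<in>UNIV. borel)"

definition point_measure_of :: "config \<Rightarrow> real measure" where
  "point_measure_of c = distr (count_space {i. enat i < fst c}) borel (snd c)"

text \<open>Particles are Ulam-Harris labels, the root being \<open>[]\<close> and the children of \<open>u\<close> being
  \<open>u @ [i]\<close>. The random configuration \<open>L u\<close> lists the displacements, relative to \<open>u\<close>, of the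
  children of \<open>u\<close>. It is attached to every label, whether or not that label is realised in the
  tree.\<close>

locale branching_random_walk = prob_space P
  for P :: "'a measure" +
  fixes L :: "nat list \<Rightarrow> 'a \<Rightarrow> config"
  assumes indep: "indep_vars (\<lambda>_. config_space) L UNIV"
    and identically_distributed: "\<And>u. distr P config_space (L u) = distr P config_space (L [])"

inductive_set tree :: "(nat list \<Rightarrow> 'a \<Rightarrow> config) \<Rightarrow> 'a \<Rightarrow> nat list set"
  for L :: "nat list \<Rightarrow> 'a \<Rightarrow> config" and \<omega> :: 'a where
  root: "[] \<in> tree L \<omega>"
| child: "u \<in> tree L \<omega> \<Longrightarrow> enat i < fst (L u \<omega>) \<Longrightarrow> u @ [i] \<in> tree L \<omega>"

definition position :: "(nat list \<Rightarrow> 'a \<Rightarrow> config) \<Rightarrow> 'a \<Rightarrow> nat list \<Rightarrow> real" where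
  "position L \<omega> u = (\<Sum>k<length u. snd (L (take k u) \<omega>) (u ! k))"

lemma position_root: "position L \<omega> [] = 0"
  by (simp add: position_def)

lemma position_child: "position L \<omega> (u @ [i]) = position L \<omega> u + snd (L u \<omega>) i"
  by (simp add: position_def nth_append)

text \<open>The reproduction point process is the offspring point process of the root, and its intensity
  is the measure \<open>A \<mapsto> E[\<aleph>(A)]\<close>.\<close>

definition reproduction :: "(nat list \<Rightarrow> 'a \<Rightarrow> config) \<Rightarrow> 'a \<Rightarrow> real measure" where
  "reproduction L \<omega> = point_measure_of (L [] \<omega>)"

definition intensity :: "'a measure \<Rightarrow> (nat list \<Rightarrow> 'a \<Rightarrow> config) \<Rightarrow> real measure" where
  "intensity P L =
     measure_of UNIV (sets borel) (\<lambda>A. \<integral>\<^sup>+\<omega>. emeasure (reproduction L \<omega>) A \<partial>P)"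

definition survival :: "'a measure \<Rightarrow> (nat list \<Rightarrow> 'a \<Rightarrow> config) \<Rightarrow> 'a set" where
  "survival P L = {\<omega> \<in> space P. infinite (tree L \<omega>)}"

definition P_star :: "'a measure \<Rightarrow> (nat list \<Rightarrow> 'a \<Rightarrow> config) \<Rightarrow> 'a measure" where
  "P_star P L = uniform_measure P (survival P L)"

datatype ray = Finite_Ray "nat list list" | Infinite_Ray "nat \<Rightarrow> nat list"

definition is_child :: "nat list \<Rightarrow> nat list \<Rightarrow> bool" where
  "is_child u v \<longleftrightarrow> (\<exists>i. v = u @ [i])"

definition is_leaf :: "nat list set \<Rightarrow> nat list \<Rightarrow> bool" where
  "is_leaf T u \<longleftrightarrow> u \<in> T \<and> (\<forall>v\<in>T. \<not> is_child u v)"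

primrec is_ray :: "nat list set \<Rightarrow> ray \<Rightarrow> bool" where
  "is_ray T (Finite_Ray us) \<longleftrightarrow>
     us \<noteq> [] \<and> hd us = [] \<and> set us \<subseteq> T \<and> is_leaf T (last us) \<and>
     (\<forall>n. Suc n < length us \<longrightarrow> is_child (us ! n) (us ! Suc n))"
| "is_ray T (Infinite_Ray \<xi>) \<longleftrightarrow>
     \<xi> 0 = [] \<and> range \<xi> \<subseteq> T \<and> (\<forall>n. is_child (\<xi> n) (\<xi> (Suc n)))"

definition rays :: "nat list set \<Rightarrow> ray set" where
  "rays T = {\<xi>. is_ray T \<xi>}"

primrec ray_sum :: "(nat list \<Rightarrow> ennreal) \<Rightarrow> ray \<Rightarrow> ennreal" where
  "ray_sum f (Finite_Ray us) = (\<Sum>u\<leftarrow>us. f u)"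
| "ray_sum f (Infinite_Ray \<xi>) = (\<Sum>n. f (\<xi> n))"

definition M_sup :: "(nat list \<Rightarrow> 'a \<Rightarrow> config) \<Rightarrow> 'a \<Rightarrow> ennreal" where
  "M_sup L \<omega> =
     (SUP \<xi>\<in>rays (tree L \<omega>). ray_sum (\<lambda>u. ennreal (exp (- position L \<omega> u))) \<xi>)"

definition Xi_sup :: "(nat list \<Rightarrow> 'a \<Rightarrow> config) \<Rightarrow> real \<Rightarrow> 'a \<Rightarrow> ennreal" where
  "Xi_sup L b \<omega> =
     (SUP \<xi>\<in>rays (tree L \<omega>).
        ray_sum (\<lambda>u. ennreal ((1 + \<bar>position L \<omega> u\<bar>) powr (- b))) \<xi>)"

definition ln_ennreal :: "ennreal \<Rightarrow> ereal" where
  "ln_ennreal x = (if x = 0 then -\<infinity> else if x = \<top> then \<infinity> else ereal (ln (enn2real x)))"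

definition phi :: "real measure \<Rightarrow> real \<Rightarrow> ereal" where
  "phi \<mu> t = ln_ennreal (\<integral>\<^sup>+x. ennreal (exp (- t * x)) \<partial>\<mu>)"

definition tilted_neg :: "real measure \<Rightarrow> real \<Rightarrow> ennreal" where
  "tilted_neg \<mu> t = (\<integral>\<^sup>+x\<in>{..<0}. ennreal (\<bar>x\<bar> * exp (- t * x)) \<partial>\<mu>)"

definition tilted_pos :: "real measure \<Rightarrow> real \<Rightarrow> ennreal" where
  "tilted_pos \<mu> t = (\<integral>\<^sup>+x\<in>{0<..}. ennreal (x * exp (- t * x)) \<partial>\<mu>)"

definition tilted_mean_well_defined :: "real measure \<Rightarrow> real \<Rightarrow> bool" where
  "tilted_mean_well_defined \<mu> t \<longleftrightarrow> tilted_neg \<mu> t < \<infinity> \<or> tilted_pos \<mu> t < \<infinity>"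

text \<open>The integral of \<open>x * exp (- t * x)\<close> with values in the extended reals; meaningful only if
  \<open>tilted_mean_well_defined \<mu> t\<close>.\<close>

definition tilted_mean :: "real measure \<Rightarrow> real \<Rightarrow> ereal" where
  "tilted_mean \<mu> t = enn2ereal (tilted_pos \<mu> t) - enn2ereal (tilted_neg \<mu> t)"

definition tilted_second_moment :: "real measure \<Rightarrow> real \<Rightarrow> ennreal" where
  "tilted_second_moment \<mu> t = (\<integral>\<^sup>+x. ennreal (x\<^sup>2 * exp (- t * x)) \<partial>\<mu>)"

definition H1 :: "real measure \<Rightarrow> bool" where
  "H1 \<mu> \<longleftrightarrow>
     (\<exists>t>0. phi \<mu> t = 0 \<and> (\<forall>s>0. phi \<mu> s = 0 \<longrightarrow> t \<le> s) \<and>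
        tilted_mean_well_defined \<mu> t \<and> tilted_mean \<mu> t \<noteq> 0)"

definition H2 :: "real measure \<Rightarrow> bool" where
  "H2 \<mu> \<longleftrightarrow>
     (\<exists>t>0. phi \<mu> t = 0 \<and> (\<forall>s>0. 0 \<le> phi \<mu> s) \<and>
        tilted_mean_well_defined \<mu> t \<and> tilted_mean \<mu> t = 0 \<and>
        0 < tilted_second_moment \<mu> t \<and> tilted_second_moment \<mu> t < \<infinity>)"

context branching_random_walk
begin

lemma measurable_L [measurable]: "L u \<in> P \<rightarrow>\<^sub>M config_space"
  using indep by (auto simp: indep_vars_def)

lemma measurable_offspring_number [measurable]: "(\<lambda>\<omega>. fst (L u \<omega>)) \<in> P \<rightarrow>\<^sub>M count_space UNIV"
  using measurable_L[of u] unfolding config_space_def by measurable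

lemma measurable_displacement [measurable]: "(\<lambda>\<omega>. snd (L u \<omega>) i) \<in> borel_measurable P"
proof -
  have "(\<lambda>\<omega>. snd (L u \<omega>)) \<in> P \<rightarrow>\<^sub>M (\<Pi>\<^sub>M i\<in>UNIV. borel)"
    using measurable_L[of u] unfolding config_space_def by measurable
  then show ?thesis
    by (rule measurable_compose) simp
qed

lemma in_tree_snoc_iff: "u @ [i] \<in> tree L \<omega> \<longleftrightarrow> u \<in> tree L \<omega> \<and> enat i < fst (L u \<omega>)"
  by (auto intro: tree.intros elim: tree.cases)

lemma measurable_in_tree [measurable]: "Measurable.pred P (\<lambda>\<omega>. u \<in> tree L \<omega>)"
proof (induction u rule: rev_induct)
  case Nil
  then show ?case by (simp add: tree.root)
next
  case (snoc i u)
  then show ?case unfolding in_tree_snoc_iff by measurable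
qed

lemma sets_survival: "survival P L \<in> sets P"
proof -
  have eq: "finite (tree L \<omega>) \<longleftrightarrow> (\<exists>us. \<forall>u. u \<in> tree L \<omega> \<longrightarrow> u \<in> set us)" for \<omega>
    by (metis List.finite_set finite_list finite_subset subsetI)
  have "Measurable.pred P (\<lambda>\<omega>. \<exists>us. \<forall>u. u \<in> tree L \<omega> \<longrightarrow> u \<in> set us)"
    by measurable
  then have "Measurable.pred P (\<lambda>\<omega>. infinite (tree L \<omega>))"
    unfolding eq[symmetric] by measurable
  then show ?thesis
    unfolding survival_def by measurable
qed

lemma emeasure_reproduction:
  assumes "A \<in> sets borel"
  shows "emeasure (reproduction L \<omega>) A =
    (\<Sum>i. indicator {i. enat i < fst (L [] \<omega>) \<and> snd (L [] \<omega>) i \<in> A} i)"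
proof -
  have "emeasure (reproduction L \<omega>) A =
      emeasure (count_space {i. enat i < fst (L [] \<omega>)})
        {i. enat i < fst (L [] \<omega>) \<and> snd (L [] \<omega>) i \<in> A}"
    unfolding reproduction_def point_measure_of_def using assms
    by (subst emeasure_distr) (auto intro!: arg_cong2[where f = emeasure])
  also have "\<dots> = emeasure (count_space UNIV) {i. enat i < fst (L [] \<omega>) \<and> snd (L [] \<omega>) i \<in> A}"
    by (subst (1 2) emeasure_count_space) auto
  also have "\<dots> = (\<integral>\<^sup>+i. indicator {i. enat i < fst (L [] \<omega>) \<and> snd (L [] \<omega>) i \<in> A} i
      \<partial>count_space UNIV)"
    by simp
  finally show ?thesis
    by (simp add: nn_integral_count_space_nat)
qed

lemma measurable_emeasure_reproduction [measurable]:
  assumes [measurable]: "A \<in> sets borel"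
  shows "(\<lambda>\<omega>. emeasure (reproduction L \<omega>) A) \<in> borel_measurable P"
  unfolding emeasure_reproduction[OF assms] indicator_def by measurable

lemma sets_intensity [simp, measurable_cong]: "sets (intensity P L) = sets borel"
  unfolding intensity_def by (subst sets_measure_of) (auto simp: sets.sigma_sets_eq[of borel, simplified])

lemma emeasure_intensity:
  assumes "A \<in> sets borel"
  shows "emeasure (intensity P L) A = (\<integral>\<^sup>+\<omega>. emeasure (reproduction L \<omega>) A \<partial>P)"
proof (rule emeasure_measure_of[OF intensity_def])
  have sets_eq: "sets (reproduction L \<omega>) = sets borel" for \<omega>
    by (simp add: reproduction_def point_measure_of_def)
  show "countably_additive (sets (intensity P L)) (\<lambda>A. \<integral>\<^sup>+\<omega>. emeasure (reproduction L \<omega>) A \<partial>P)"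
  proof (rule countably_additiveI)
    fix A :: "nat \<Rightarrow> real set"
    assume A: "range A \<subseteq> sets (intensity P L)" "disjoint_family A"
    then have [measurable]: "A i \<in> sets borel" for i by auto
    have "(\<Sum>i. \<integral>\<^sup>+\<omega>. emeasure (reproduction L \<omega>) (A i) \<partial>P) =
        (\<integral>\<^sup>+\<omega>. (\<Sum>i. emeasure (reproduction L \<omega>) (A i)) \<partial>P)"
      by (rule nn_integral_suminf[symmetric]) measurable
    also have "\<dots> = (\<integral>\<^sup>+\<omega>. emeasure (reproduction L \<omega>) (\<Union>i. A i) \<partial>P)"
      using A by (intro nn_integral_cong suminf_emeasure) (auto simp: sets_eq)
    finally show "(\<Sum>i. \<integral>\<^sup>+\<omega>. emeasure (reproduction L \<omega>) (A i) \<partial>P) =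
        (\<integral>\<^sup>+\<omega>. emeasure (reproduction L \<omega>) (\<Union>i. A i) \<partial>P)" .
  qed
qed (use assms in \<open>auto simp: positive_def\<close>)

end

end

theory Submission
  imports Defs
begin

text \<open>Fix \<open>t > 0\<close> with \<open>\<phi>(t) = 0\<close>. Then \<open>\<nu>(dx) = exp (- t * x) \<mu>(dx)\<close> is a probability law, and if every
particle is given the weight \<open>exp (- t * V(u))\<close>, expectations of sums over a generation become
expectations for the random walk with step law \<open>\<nu>\<close>. Under the first hypothesis this walk has a
nonzero, possibly infinite mean; under the second it is centred and not degenerate.

Divide the line into the cells \<open>j \<le> \<bar>x\<bar> < j + 1\<close>. It suffices to bound, simultaneously for all rays,
the number of visits to cell \<open>j\<close>. Suppose that, killed outside some set \<open>K\<close>, the walk started in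
cell \<open>j\<close> visits this cell at most \<open>g\<^sub>j\<close> times on average. Then visits have an exponential moment of
rate about \<open>1 / (2 * g\<^sub>j)\<close>, also when weighted sums over all particles that stay in \<open>K\<close> are taken
(\<open>expected_cell_visits_le\<close>). A particle in cell \<open>j\<close> weighs at least \<open>exp (- t * (j + 1))\<close>, so a
particle with \<open>N\<close> visits can exist only if \<open>N / g\<^sub>j\<close> is at most a random constant times \<open>1 + j\<close>
(\<open>AE_visits_polynomial\<close>). A ray therefore visits cell \<open>j\<close> at most \<open>O(j * g\<^sub>j)\<close> times, and the sum of
\<open>(1 + \<bar>V\<bar>) powr (- b)\<close> along it is at most a constant times the series of \<open>j * g\<^sub>j * j powr (- b)\<close>.

For a walk with drift, \<open>g\<^sub>j\<close> is bounded, which leads to \<open>b > 2\<close>. In the centred case, positions are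
almost surely bounded below by a random level \<open>-A\<close> (\<open>AE_positions_bounded_below\<close>), so the walk may be
killed below \<open>-A\<close>; then \<open>g\<^sub>j = O(j)\<close>, which leads to \<open>b > 3\<close>. As \<open>exp (- V)\<close> is dominated by
\<open>(1 + \<bar>V\<bar>) powr (- 4)\<close> on positions above \<open>-A\<close>, the exponential ray sums are finite in both cases.

Both bounds on \<open>g\<^sub>j\<close> come from cutting the path at the first time of its minimum
(\<open>green_le_split_at_minimum\<close>; for a drift to the left, the maximum). By time reversal, visits to an
interval after that time are counted by records of the walk in the interval. Every record has the same
positive chance of being followed by a jump of size at least some \<open>\<delta>\<close>, and records with such a jump are
\<open>\<delta>\<close>-separated, so their expected number is at most a multiple of one plus the length of the interval
(\<open>expected_records_le\<close>). The possible minima are counted in the same way when the walk is killed below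
\<open>-A\<close>, and by Wald's identity, as an exit time, when there is a drift.\<close>

section \<open>The random walk and its Green function\<close>

definition walk :: "(nat \<Rightarrow> real) \<Rightarrow> nat \<Rightarrow> real" where
  "walk \<omega> n = (\<Sum>i<n. \<omega> i)"

lemma walk_0 [simp]: "walk \<omega> 0 = 0"
  by (simp add: walk_def)

lemma walk_Suc: "walk \<omega> (Suc n) = walk \<omega> n + \<omega> n"
  by (simp add: walk_def)

lemma walk_case_nat: "walk (case_nat y \<omega>) (Suc n) = y + walk \<omega> n"
  by (simp add: walk_def sum.lessThan_Suc_shift del: sum.lessThan_Suc)

lemma walk_comb_seq_le: "n \<le> m \<Longrightarrow> walk (comb_seq m \<omega> \<omega>') n = walk \<omega> n"
  unfolding walk_def by (rule sum.cong) (auto simp: comb_seq_def)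

lemma walk_comb_seq_add: "walk (comb_seq m \<omega> \<omega>') (m + n) = walk \<omega> m + walk \<omega>' n"
proof (induction n)
  case 0
  then show ?case using walk_comb_seq_le[of m m] by simp
next
  case (Suc n)
  then show ?case by (simp add: walk_Suc comb_seq_def)
qed


lemma borel_measurable_pred_le [measurable (raw)]:
  fixes f g :: "'a \<Rightarrow> 'b::{second_countable_topology, linorder_topology}"
  shows "f \<in> borel_measurable M \<Longrightarrow> g \<in> borel_measurable M \<Longrightarrow> Measurable.pred M (\<lambda>w. f w \<le> g w)"
  unfolding Measurable.pred_def by (rule borel_measurable_le)

lemma of_bool_mono: "(P \<Longrightarrow> Q) \<Longrightarrow> of_bool P \<le> (of_bool Q :: ennreal)"
  by auto

lemma measurable_walk [measurable]:
  "(\<lambda>\<omega>. walk \<omega> n) \<in> borel_measurable (\<Pi>\<^sub>M i\<in>UNIV. borel)"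
  unfolding walk_def by measurable

text \<open>The walk lives on the product space \<open>S\<close> of step sequences. Three symmetries of this space carry
the argument: it is a fresh copy of itself after one step, it splits into independent halves at
any time, and it is invariant under reversing the first \<open>n\<close> steps.\<close>

locale step_law = prob_space \<nu> for \<nu> :: "real measure" +
  assumes sets_step [measurable_cong]: "sets \<nu> = sets borel"
begin

sublocale sequence_space \<nu>
  by unfold_locales

lemma prob_space_step: "prob_space \<nu>"
  by unfold_locales

lemma space_step [simp]: "space \<nu> = UNIV"
  using sets_eq_imp_space_eq[OF sets_step] by simp

lemma emeasure_step: "emeasure \<nu> A = ennreal (measure \<nu> A)"
  by (rule finite_measure.emeasure_eq_measure[OF prob_space.finite_measure[OF prob_space_step]])

lemma measure_step_mono: "A \<subseteq> B \<Longrightarrow> B \<in> sets borel \<Longrightarrow> measure \<nu> A \<le> measure \<nu> B"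
  using finite_measure.finite_measure_mono[OF prob_space.finite_measure[OF prob_space_step]]
  by (simp add: sets_step)

lemma measure_step_UNIV [simp]: "measure \<nu> UNIV = 1"
  using prob_space.prob_space[OF prob_space_step] by simp

lemma nn_integral_first_step:
  assumes [measurable]: "f \<in> borel_measurable S"
  shows "(\<integral>\<^sup>+\<omega>. f \<omega> \<partial>S) = (\<integral>\<^sup>+y. \<integral>\<^sup>+\<omega>. f (case_nat y \<omega>) \<partial>S \<partial>\<nu>)"
proof -
  have "(\<integral>\<^sup>+\<omega>. f \<omega> \<partial>S) = (\<integral>\<^sup>+\<omega>. f \<omega> \<partial>distr (\<nu> \<Otimes>\<^sub>M S) S (\<lambda>(s, \<omega>). case_nat s \<omega>))"
    by (simp add: PiM_iter)
  also have "\<dots> = (\<integral>\<^sup>+z. f ((\<lambda>(s, \<omega>). case_nat s \<omega>) z) \<partial>(\<nu> \<Otimes>\<^sub>M S))"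
    by (rule nn_integral_distr) measurable
  also have "\<dots> = (\<integral>\<^sup>+y. \<integral>\<^sup>+\<omega>. f (case_nat y \<omega>) \<partial>S \<partial>\<nu>)"
    by (subst P.nn_integral_fst[symmetric]) auto
  finally show ?thesis .
qed

lemma nn_integral_split_walk:
  assumes [measurable]: "f \<in> borel_measurable S"
  shows "(\<integral>\<^sup>+\<omega>. f \<omega> \<partial>S) = (\<integral>\<^sup>+\<omega>. \<integral>\<^sup>+\<omega>'. f (comb_seq m \<omega> \<omega>') \<partial>S \<partial>S)"
proof -
  have "(\<integral>\<^sup>+\<omega>. f \<omega> \<partial>S) = (\<integral>\<^sup>+\<omega>. f \<omega> \<partial>distr (S \<Otimes>\<^sub>M S) S (\<lambda>(\<omega>, \<omega>'). comb_seq m \<omega> \<omega>'))"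
    by (simp add: PiM_comb_seq)
  also have "\<dots> = (\<integral>\<^sup>+z. f ((\<lambda>(\<omega>, \<omega>'). comb_seq m \<omega> \<omega>') z) \<partial>(S \<Otimes>\<^sub>M S))"
    by (rule nn_integral_distr) measurable
  also have "\<dots> = (\<integral>\<^sup>+\<omega>. \<integral>\<^sup>+\<omega>'. f (comb_seq m \<omega> \<omega>') \<partial>S \<partial>S)"
    by (subst P.nn_integral_fst[symmetric]) auto
  finally show ?thesis .
qed

lemma nn_integral_reverse:
  assumes [measurable]: "f \<in> borel_measurable S"
  shows "(\<integral>\<^sup>+\<omega>. f \<omega> \<partial>S) = (\<integral>\<^sup>+\<omega>. f (\<lambda>i. \<omega> (if i < n then n - Suc i else i)) \<partial>S)"
proof -
  define \<pi> where "\<pi> i = (if i < n then n - Suc i else i)" for i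
  have "inj \<pi>"
    by (auto simp: inj_def \<pi>_def split: if_splits)
  have m: "(\<lambda>\<omega>. \<lambda>i\<in>UNIV. \<omega> (\<pi> i)) \<in> S \<rightarrow>\<^sub>M S"
    by (rule measurable_restrict) measurable
  have "distr S S (\<lambda>\<omega>. \<lambda>i\<in>UNIV. \<omega> (\<pi> i)) = S"
    using \<open>inj \<pi>\<close>
    by (intro distr_PiM_reindex) (auto intro: prob_space_step)
  then have "(\<integral>\<^sup>+\<omega>. f \<omega> \<partial>S) = (\<integral>\<^sup>+\<omega>. f \<omega> \<partial>distr S S (\<lambda>\<omega>. \<lambda>i\<in>UNIV. \<omega> (\<pi> i)))"
    by simp
  also have "\<dots> = (\<integral>\<^sup>+\<omega>. f (\<lambda>i. \<omega> (\<pi> i)) \<partial>S)"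
    using m by (subst nn_integral_distr) (auto simp: restrict_UNIV)
  finally show ?thesis
    by (simp add: \<pi>_def)
qed

lemma walk_reverse:
  assumes "i \<le> n"
  shows "walk (\<lambda>i. \<omega> (if i < n then n - Suc i else i)) i = walk \<omega> n - walk \<omega> (n - i)"
  using assms
proof (induction i)
  case (Suc i)
  then have "n - i = Suc (n - Suc i)" by simp
  with Suc show ?case by (simp add: walk_Suc)
qed simp

text \<open>The walk is started at \<open>x\<close> and killed on leaving \<open>K\<close>; \<open>green K I x\<close> is then its expected number
of visits to \<open>I\<close>, time 0 included. Killing is what keeps this finite for a centred walk.\<close>

definition visit_prob :: "real set \<Rightarrow> real set \<Rightarrow> nat \<Rightarrow> real \<Rightarrow> ennreal" where
  "visit_prob K I n x =
     (\<integral>\<^sup>+\<omega>. of_bool ((\<forall>i\<le>n. x + walk \<omega> i \<in> K) \<and> x + walk \<omega> n \<in> I) \<partial>S)"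

definition green :: "real set \<Rightarrow> real set \<Rightarrow> real \<Rightarrow> ennreal" where
  "green K I x = (\<Sum>n. visit_prob K I n x)"

context
  fixes K I :: "real set"
  assumes K [measurable]: "K \<in> sets borel" and I [measurable]: "I \<in> sets borel"
begin

lemma measurable_visit_prob [measurable]: "visit_prob K I n \<in> borel_measurable borel"
  unfolding visit_prob_def by measurable

lemma measurable_green [measurable]: "green K I \<in> borel_measurable borel"
  unfolding green_def by measurable

lemma visit_prob_0: "visit_prob K I 0 x = of_bool (x \<in> K) * of_bool (x \<in> I)"
  by (simp add: visit_prob_def P.emeasure_space_1 of_bool_conj)

lemma visit_prob_Suc:
  "visit_prob K I (Suc n) x = of_bool (x \<in> K) * (\<integral>\<^sup>+y. visit_prob K I n (x + y) \<partial>\<nu>)"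
proof -
  have "visit_prob K I (Suc n) x = (\<integral>\<^sup>+y. \<integral>\<^sup>+\<omega>.
     of_bool ((\<forall>i\<le>Suc n. x + walk (case_nat y \<omega>) i \<in> K) \<and> x + walk (case_nat y \<omega>) (Suc n) \<in> I) \<partial>S \<partial>\<nu>)"
    unfolding visit_prob_def by (rule nn_integral_first_step) measurable
  also have "\<dots> = (\<integral>\<^sup>+y. \<integral>\<^sup>+\<omega>.
     of_bool (x \<in> K) * of_bool ((\<forall>i\<le>n. x + y + walk \<omega> i \<in> K) \<and> x + y + walk \<omega> n \<in> I) \<partial>S \<partial>\<nu>)"
    unfolding atMost_iff[symmetric] atMost_Suc_eq_insert_0
    by (intro nn_integral_cong) (auto simp: walk_case_nat add.assoc)
  also have "\<dots> = (\<integral>\<^sup>+y. of_bool (x \<in> K) * visit_prob K I n (x + y) \<partial>\<nu>)"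
    unfolding visit_prob_def by (subst nn_integral_cmult) auto
  also have "\<dots> = of_bool (x \<in> K) * (\<integral>\<^sup>+y. visit_prob K I n (x + y) \<partial>\<nu>)"
    by (rule nn_integral_cmult) measurable
  finally show ?thesis .
qed

lemma green_eq:
  "green K I x = of_bool (x \<in> K) * (of_bool (x \<in> I) + (\<integral>\<^sup>+y. green K I (x + y) \<partial>\<nu>))"
proof -
  have "green K I x = visit_prob K I 0 x + (\<Sum>n. visit_prob K I (Suc n) x)"
    unfolding green_def
    using suminf_offset[of "\<lambda>n. visit_prob K I n x" 1] by (simp add: add.commute)
  then have "green K I x = (\<Sum>n. visit_prob K I (Suc n) x) + visit_prob K I 0 x"
    by (simp add: add.commute)
  also have "(\<Sum>n. visit_prob K I (Suc n) x) = of_bool (x \<in> K) * (\<integral>\<^sup>+y. green K I (x + y) \<partial>\<nu>)"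
    unfolding visit_prob_Suc green_def by (subst nn_integral_suminf) auto
  finally show ?thesis
    by (simp add: visit_prob_0 distrib_left add.commute)
qed

lemma green_outside: "x \<notin> K \<Longrightarrow> green K I x = 0"
  by (subst green_eq) simp

text \<open>The Green function is the least nonnegative solution of its one-step equation, so any
superharmonic majorant found by hand bounds it.\<close>

lemma green_le_superharmonic:
  assumes [measurable]: "\<psi> \<in> borel_measurable borel"
  assumes super: "\<And>x. x \<in> K \<Longrightarrow> of_bool (x \<in> I) + (\<integral>\<^sup>+y. \<psi> (x + y) \<partial>\<nu>) \<le> \<psi> x"
  shows "green K I x \<le> \<psi> x"
proof -
  have "(\<Sum>k<n. visit_prob K I k x) \<le> \<psi> x" for n
  proof (induction n arbitrary: x)
    case (Suc n)
    have "(\<Sum>k<Suc n. visit_prob K I k x) =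
        of_bool (x \<in> K) * (of_bool (x \<in> I) + (\<Sum>k<n. \<integral>\<^sup>+y. visit_prob K I k (x + y) \<partial>\<nu>))"
      by (simp add: sum.lessThan_Suc_shift visit_prob_0 visit_prob_Suc distrib_left sum_distrib_left
          del: sum.lessThan_Suc)
    also have "(\<Sum>k<n. \<integral>\<^sup>+y. visit_prob K I k (x + y) \<partial>\<nu>) =
        (\<integral>\<^sup>+y. (\<Sum>k<n. visit_prob K I k (x + y)) \<partial>\<nu>)"
      by (rule nn_integral_sum[symmetric]) measurable
    also have "\<dots> \<le> (\<integral>\<^sup>+y. \<psi> (x + y) \<partial>\<nu>)"
      by (intro nn_integral_mono Suc.IH)
    finally have "(\<Sum>k<Suc n. visit_prob K I k x) \<le>
        of_bool (x \<in> K) * (of_bool (x \<in> I) + (\<integral>\<^sup>+y. \<psi> (x + y) \<partial>\<nu>))"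
      by (auto intro: order_trans mult_left_mono add_left_mono)
    also have "\<dots> \<le> \<psi> x"
      using super[of x] by auto
    finally show ?case .
  qed simp
  then show ?thesis
    unfolding green_def by (intro suminf_le_const) auto
qed

end

end

section \<open>Records and minima of a path\<close>

text \<open>The factor \<open>c\<close> will be \<open>1\<close> or \<open>-1\<close>, so that one statement covers a walk and its mirror image:
for \<open>c = -1\<close> weak records are weak minima and new minima are strict maxima.\<close>

definition weak_record :: "real \<Rightarrow> (nat \<Rightarrow> real) \<Rightarrow> nat \<Rightarrow> bool" where
  "weak_record c \<omega> m \<longleftrightarrow> (\<forall>i\<le>m. c * walk \<omega> i \<le> c * walk \<omega> m)"

definition new_minimum :: "real \<Rightarrow> (nat \<Rightarrow> real) \<Rightarrow> nat \<Rightarrow> bool" where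
  "new_minimum c \<omega> m \<longleftrightarrow> (\<forall>i<m. c * walk \<omega> m < c * walk \<omega> i)"

definition stays_above :: "real \<Rightarrow> nat \<Rightarrow> (nat \<Rightarrow> real) \<Rightarrow> nat \<Rightarrow> bool" where
  "stays_above c m \<omega> l \<longleftrightarrow> (\<forall>i\<le>l. c * walk \<omega> m \<le> c * walk \<omega> (m + i))"

definition record_steps :: "(nat \<Rightarrow> real) \<Rightarrow> real \<Rightarrow> real set \<Rightarrow> nat set" where
  "record_steps \<omega> c J = {m. walk \<omega> m \<in> J \<and> weak_record c \<omega> m}"

text \<open>After a record that is followed by a jump of size at least \<open>\<delta>\<close>, every later record is at least
\<open>\<delta>\<close> higher. Records of this kind are therefore \<open>\<delta>\<close>-separated, and an interval of length \<open>l\<close> holds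
at most \<open>l / \<delta> + 1\<close> of them along any deterministic path.\<close>

lemma card_record_steps_with_jump:
  fixes \<delta> l b c :: real and \<omega> :: "nat \<Rightarrow> real"
  assumes c: "\<bar>c\<bar> = 1" and \<delta>: "\<delta> > 0" and l: "l \<ge> 0"
  defines "A \<equiv> {m \<in> record_steps \<omega> c {b..b + l}. \<delta> \<le> c * \<omega> m}"
  shows "finite A" and "real (card A) \<le> l / \<delta> + 1"
proof -
  \<comment> \<open>Separated points lie in different boxes of length \<open>\<delta>\<close>, so the box number is injective.\<close>
  define g where "g m = nat \<lfloor>(walk \<omega> m - b) / \<delta>\<rfloor>" for m
  have sep: "\<delta> \<le> \<bar>walk \<omega> m' - walk \<omega> m\<bar>" if "m \<in> A" "m' \<in> A" "m < m'" for m m'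
  proof -
    have "c * walk \<omega> (Suc m) \<le> c * walk \<omega> m'" "\<delta> \<le> c * \<omega> m"
      using that by (auto simp: A_def record_steps_def weak_record_def)
    then have "\<delta> \<le> c * (walk \<omega> m' - walk \<omega> m)"
      by (simp add: walk_Suc algebra_simps)
    also have "\<dots> \<le> \<bar>c\<bar> * \<bar>walk \<omega> m' - walk \<omega> m\<bar>"
      by (metis abs_ge_self abs_mult)
    finally show ?thesis using c by simp
  qed
  have nonneg: "0 \<le> (walk \<omega> m - b) / \<delta>" if "m \<in> A" for m
    using that \<delta> by (auto simp: A_def record_steps_def weak_record_def)
  have neq: "g m \<noteq> g m'" if "m \<in> A" "m' \<in> A" "m < m'" for m m'
  proof
    assume "g m = g m'"
    then have "\<lfloor>(walk \<omega> m - b) / \<delta>\<rfloor> = \<lfloor>(walk \<omega> m' - b) / \<delta>\<rfloor>"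
      using nonneg that unfolding g_def by (simp add: eq_nat_nat_iff)
    then have "\<bar>(walk \<omega> m' - b) / \<delta> - (walk \<omega> m - b) / \<delta>\<bar> < 1"
      by linarith
    then have "\<bar>walk \<omega> m' - walk \<omega> m\<bar> < \<delta>"
      using \<delta> by (simp add: diff_divide_distrib[symmetric] abs_divide)
    then show False
      using sep[OF that] by simp
  qed
  have inj: "inj_on g A"
    by (rule inj_onI) (metis neq linorder_neqE_nat)
  have img: "g ` A \<subseteq> {..nat \<lfloor>l / \<delta>\<rfloor>}"
    using \<delta> by (auto simp: g_def A_def record_steps_def weak_record_def intro!: nat_mono floor_mono divide_right_mono)
  show "finite A"
    using inj img by (rule inj_on_finite) simp
  have "card A \<le> card {..nat \<lfloor>l / \<delta>\<rfloor>}"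
    using inj img by (rule card_inj_on_le) simp
  then have "real (card A) \<le> real (nat \<lfloor>l / \<delta>\<rfloor>) + 1"
    by simp
  also have "real (nat \<lfloor>l / \<delta>\<rfloor>) \<le> l / \<delta>"
    using l \<delta> by (simp add: of_nat_nat)
  finally show "real (card A) \<le> l / \<delta> + 1"
    by simp
qed

lemma exists_first_minimum:
  fixes f :: "nat \<Rightarrow> real"
  shows "\<exists>m\<le>n. (\<forall>i<m. f m < f i) \<and> (\<forall>i\<le>n. f m \<le> f i)"
proof -
  define v where "v = Min (f ` {..n})"
  have v: "v \<le> f i" if "i \<le> n" for i
    unfolding v_def using that by (intro Min_le) auto
  have "v \<in> f ` {..n}"
    unfolding v_def by (intro Min_in) auto
  then have ex: "\<exists>m. m \<le> n \<and> f m = v" by auto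
  define m where "m = (LEAST m. m \<le> n \<and> f m = v)"
  have m: "m \<le> n \<and> f m = v"
    unfolding m_def by (rule LeastI_ex[OF ex])
  have "f m < f i" if "i < m" for i
    using not_less_Least[OF that[unfolded m_def]] v[of i] m that by auto
  with m v show ?thesis by auto
qed

text \<open>Reorganises a sum over total time into a sum over the time before and the time after a
splitting instant.\<close>

lemma suminf_triangle_le:
  fixes f :: "nat \<Rightarrow> nat \<Rightarrow> ennreal"
  shows "(\<Sum>n. \<Sum>m\<le>n. f m (n - m)) \<le> (\<Sum>m. \<Sum>l. f m l)"
proof (rule suminf_le_const)
  fix N
  have "(\<Sum>n<N. \<Sum>m\<le>n. f m (n - m)) = (\<Sum>(m, l)\<in>{(m, l). m + l < N}. f m l)"
    by (rule sum.triangle_reindex[symmetric])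
  also have "\<dots> \<le> (\<Sum>(m, l)\<in>{..<N} \<times> {..<N}. f m l)"
    by (intro sum_mono2) auto
  also have "\<dots> = (\<Sum>m<N. \<Sum>l<N. f m l)"
    by (simp add: sum.cartesian_product)
  also have "\<dots> \<le> (\<Sum>m<N. \<Sum>l. f m l)"
    by (intro sum_mono sum_le_suminf) auto
  also have "\<dots> \<le> (\<Sum>m. \<Sum>l. f m l)"
    by (intro sum_le_suminf) auto
  finally show "(\<Sum>n<N. \<Sum>m\<le>n. f m (n - m)) \<le> (\<Sum>m. \<Sum>l. f m l)" .
qed simp

section \<open>Bounds on the Green function\<close>

context step_law
begin

definition expected_records :: "real \<Rightarrow> real set \<Rightarrow> ennreal" where
  "expected_records c J = (\<Sum>m. \<integral>\<^sup>+\<omega>. of_bool (m \<in> record_steps \<omega> c J) \<partial>S)"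

lemma pred_weak_record [measurable]: "Measurable.pred S (\<lambda>\<omega>. weak_record c \<omega> m)"
proof -
  have "Measurable.pred S (\<lambda>\<omega>. c * walk \<omega> i \<le> c * walk \<omega> m)" for i
    by measurable
  then show ?thesis
    unfolding weak_record_def by (intro pred_intros_countable pred_intros_logic) simp_all
qed

lemma pred_new_minimum [measurable]: "Measurable.pred S (\<lambda>\<omega>. new_minimum c \<omega> m)"
proof -
  have "Measurable.pred S (\<lambda>\<omega>. c * walk \<omega> m < c * walk \<omega> i)" for i
    by measurable
  then show ?thesis
    unfolding new_minimum_def by (intro pred_intros_countable pred_intros_logic) simp_all
qed

lemma pred_stays_above [measurable]: "Measurable.pred S (\<lambda>\<omega>. stays_above c m \<omega> l)"
proof -
  have "Measurable.pred S (\<lambda>\<omega>. c * walk \<omega> m \<le> c * walk \<omega> (m + i))" for i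
    by measurable
  then show ?thesis
    unfolding stays_above_def by (intro pred_intros_countable pred_intros_logic) simp_all
qed

lemma pred_record_steps [measurable]:
  assumes [measurable]: "J \<in> sets borel"
  shows "Measurable.pred S (\<lambda>\<omega>. m \<in> record_steps \<omega> c J)"
  unfolding record_steps_def mem_Collect_eq by measurable

lemma nn_integral_coordinate:
  assumes [measurable]: "f \<in> borel_measurable borel"
  shows "(\<integral>\<^sup>+\<omega>. f (\<omega> m) \<partial>S) = (\<integral>\<^sup>+y. f y \<partial>\<nu>)"
proof -
  have "(\<integral>\<^sup>+y. f y \<partial>\<nu>) = (\<integral>\<^sup>+y. f y \<partial>distr S \<nu> (\<lambda>\<omega>. \<omega> m))"
    using distr_PiM_component[of UNIV "\<lambda>_. \<nu>" m] by (simp add: prob_space_step)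
  also have "\<dots> = (\<integral>\<^sup>+\<omega>. f (\<omega> m) \<partial>S)"
    by (rule nn_integral_distr) auto
  finally show ?thesis ..
qed

text \<open>Whether \<open>m\<close> is a record is decided by the steps before \<open>m\<close>, so each record is followed by a jump
of size at least \<open>\<delta>\<close> with the same probability \<open>p\<close>. The expected number of records is thus
\<open>1 / p\<close> times the expected number of records followed by such a jump, which was just counted.\<close>

lemma expected_records_le:
  fixes \<delta> l b c :: real
  assumes c: "\<bar>c\<bar> = 1" and \<delta>: "\<delta> > 0" and l: "l \<ge> 0"
  assumes p: "0 < measure \<nu> {y. \<delta> \<le> c * y}"
  shows "expected_records c {b..b + l} \<le> ennreal ((l / \<delta> + 1) / measure \<nu> {y. \<delta> \<le> c * y})"
proof -
  let ?R = "\<lambda>m \<omega>. m \<in> record_steps \<omega> c {b..b + l}"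
  let ?p = "measure \<nu> {y. \<delta> \<le> c * y}"
  have [measurable]: "{y. \<delta> \<le> c * y} \<in> sets borel"
    by measurable
  have jump: "(\<integral>\<^sup>+\<omega>. of_bool (?R m \<omega> \<and> \<delta> \<le> c * \<omega> m) \<partial>S) = (\<integral>\<^sup>+\<omega>. of_bool (?R m \<omega>) \<partial>S) * ennreal ?p" for m
  proof -
    have "(\<integral>\<^sup>+\<omega>. of_bool (?R m \<omega> \<and> \<delta> \<le> c * \<omega> m) \<partial>S) =
        (\<integral>\<^sup>+\<omega>. \<integral>\<^sup>+\<omega>'. of_bool (?R m (comb_seq m \<omega> \<omega>') \<and> \<delta> \<le> c * comb_seq m \<omega> \<omega>' m) \<partial>S \<partial>S)"
      by (rule nn_integral_split_walk) measurable
    also have "\<dots> = (\<integral>\<^sup>+\<omega>. \<integral>\<^sup>+\<omega>'. of_bool (?R m \<omega>) * of_bool (\<delta> \<le> c * \<omega>' 0) \<partial>S \<partial>S)"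
      by (intro nn_integral_cong)
        (auto simp: record_steps_def weak_record_def walk_comb_seq_le comb_seq_def of_bool_conj[symmetric])
    also have "\<dots> = (\<integral>\<^sup>+\<omega>. of_bool (?R m \<omega>) * (\<integral>\<^sup>+\<omega>'. of_bool (\<delta> \<le> c * \<omega>' 0) \<partial>S) \<partial>S)"
      by (intro nn_integral_cong nn_integral_cmult) measurable
    also have "(\<integral>\<^sup>+\<omega>'. of_bool (\<delta> \<le> c * \<omega>' 0) \<partial>S) = (\<integral>\<^sup>+y. of_bool (\<delta> \<le> c * y) \<partial>\<nu>)"
      by (rule nn_integral_coordinate) measurable
    also have "\<dots> = (\<integral>\<^sup>+y. indicator {y. \<delta> \<le> c * y} y \<partial>\<nu>)"
      by (intro nn_integral_cong) (auto simp: indicator_def)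
    also have "\<dots> = ennreal ?p"
      by (subst nn_integral_indicator) (auto simp: sets_step emeasure_step)
    also have "(\<integral>\<^sup>+\<omega>. of_bool (?R m \<omega>) * ennreal ?p \<partial>S) = (\<integral>\<^sup>+\<omega>. of_bool (?R m \<omega>) \<partial>S) * ennreal ?p"
      by (rule nn_integral_multc) measurable
    finally show ?thesis .
  qed
  have "expected_records c {b..b + l} * ennreal ?p = (\<Sum>m. \<integral>\<^sup>+\<omega>. of_bool (?R m \<omega> \<and> \<delta> \<le> c * \<omega> m) \<partial>S)"
    unfolding expected_records_def jump by simp
  also have "\<dots> = (\<integral>\<^sup>+\<omega>. (\<Sum>m. of_bool (?R m \<omega> \<and> \<delta> \<le> c * \<omega> m)) \<partial>S)"
    by (rule nn_integral_suminf[symmetric]) measurable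
  also have "\<dots> \<le> (\<integral>\<^sup>+\<omega>. ennreal (l / \<delta> + 1) \<partial>S)"
  proof (rule nn_integral_mono)
    fix \<omega>
    let ?A = "{m \<in> record_steps \<omega> c {b..b + l}. \<delta> \<le> c * \<omega> m}"
    note A = card_record_steps_with_jump[OF c \<delta> l, of \<omega> b]
    have "(\<Sum>m. of_bool (?R m \<omega> \<and> \<delta> \<le> c * \<omega> m) :: ennreal) = (\<Sum>m\<in>?A. of_bool (?R m \<omega> \<and> \<delta> \<le> c * \<omega> m))"
      by (rule suminf_finite[OF A(1)]) auto
    also have "\<dots> = (\<Sum>m\<in>?A. 1)"
      by (rule sum.cong) auto
    also have "\<dots> = ennreal (real (card ?A))"
      by (simp add: ennreal_of_nat_eq_real_of_nat)
    also have "\<dots> \<le> ennreal (l / \<delta> + 1)"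
      using A(2) by (rule ennreal_leI)
    finally show "(\<Sum>m. of_bool (?R m \<omega> \<and> \<delta> \<le> c * \<omega> m)) \<le> ennreal (l / \<delta> + 1)" .
  qed
  also have "\<dots> = ennreal (l / \<delta> + 1)"
    by (simp add: P.emeasure_space_1)
  finally have "expected_records c {b..b + l} * ennreal ?p \<le> ennreal (l / \<delta> + 1)" .
  then have "expected_records c {b..b + l} * ennreal ?p / ennreal ?p \<le> ennreal (l / \<delta> + 1) / ennreal ?p"
    by (rule divide_right_mono_ennreal)
  then show ?thesis
    using p l \<delta> by (simp add: ennreal_mult_divide_eq divide_ennreal del: ennreal_plus)
qed

text \<open>Duality: reversing the first \<open>l\<close> steps replaces the path by its increments seen from the end, so
staying above the starting level up to time \<open>l\<close> turns into having a weak record at time \<open>l\<close>.\<close>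

lemma expected_stay_visits_eq_records:
  assumes [measurable]: "I \<in> sets borel"
  shows "(\<Sum>l. \<integral>\<^sup>+\<omega>. of_bool (stays_above c 0 \<omega> l \<and> walk \<omega> l \<in> I) \<partial>S) = expected_records c I"
  unfolding expected_records_def
proof (rule suminf_cong)
  fix l
  have *: "(\<forall>i\<le>l. Q (l - i)) \<longleftrightarrow> (\<forall>i\<le>l. Q i)" for Q :: "nat \<Rightarrow> bool"
  proof safe
    fix i assume "\<forall>i\<le>l. Q (l - i)" "i \<le> l"
    then have "Q (l - (l - i))" by (metis diff_le_self)
    with \<open>i \<le> l\<close> show "Q i" by simp
  qed simp
  have "(\<integral>\<^sup>+\<omega>. of_bool (stays_above c 0 \<omega> l \<and> walk \<omega> l \<in> I) \<partial>S) =
    (\<integral>\<^sup>+\<omega>. of_bool (stays_above c 0 (\<lambda>i. \<omega> (if i < l then l - Suc i else i)) l \<and>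
        walk (\<lambda>i. \<omega> (if i < l then l - Suc i else i)) l \<in> I) \<partial>S)"
    by (rule nn_integral_reverse) measurable
  also have "\<dots> = (\<integral>\<^sup>+\<omega>. of_bool (l \<in> record_steps \<omega> c I) \<partial>S)"
  proof (rule nn_integral_cong)
    fix \<omega>
    show "of_bool (stays_above c 0 (\<lambda>i. \<omega> (if i < l then l - Suc i else i)) l \<and>
        walk (\<lambda>i. \<omega> (if i < l then l - Suc i else i)) l \<in> I) = of_bool (l \<in> record_steps \<omega> c I)"
      using *[of "\<lambda>i. c * walk \<omega> i \<le> c * walk \<omega> l"]
      by (auto simp: walk_reverse stays_above_def record_steps_def weak_record_def right_diff_distrib)
  qed
  finally show "(\<integral>\<^sup>+\<omega>. of_bool (stays_above c 0 \<omega> l \<and> walk \<omega> l \<in> I) \<partial>S) =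
    (\<integral>\<^sup>+\<omega>. of_bool (l \<in> record_steps \<omega> c I) \<partial>S)" .
qed

text \<open>Split a path that ends in \<open>I\<close> at the first time \<open>m\<close> of the minimum of \<open>c * walk\<close>. Up to \<open>m\<close> it makes a new
minimum inside \<open>K\<close>; afterwards it is an independent walk that stays above its starting level,
whose visits are counted by duality. The two counts multiply.\<close>

lemma green_le_split_at_minimum:
  assumes [measurable]: "K \<in> sets borel" "I \<in> sets borel"
  assumes B: "\<And>z. expected_records c {y. z + y \<in> I} \<le> B"
  shows "green K I x \<le>
    (\<Sum>m. \<integral>\<^sup>+\<omega>. of_bool (new_minimum c \<omega> m \<and> x + walk \<omega> m \<in> K) \<partial>S) * B"
proof -
  define R where "R m \<omega> \<longleftrightarrow> new_minimum c \<omega> m \<and> x + walk \<omega> m \<in> K" for m \<omega>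
  define D where "D l z = (\<integral>\<^sup>+\<omega>. of_bool (stays_above c 0 \<omega> l \<and> walk \<omega> l \<in> {y. z + y \<in> I}) \<partial>S)" for l z
  have [measurable]: "Measurable.pred S (R m)" for m
    unfolding R_def by measurable
  have [measurable]: "D l \<in> borel_measurable borel" for l
    unfolding D_def mem_Collect_eq by measurable
  have "visit_prob K I n x \<le> (\<Sum>m\<le>n. \<integral>\<^sup>+\<omega>. of_bool (R m \<omega>) * D (n - m) (x + walk \<omega> m) \<partial>S)" for n
  proof -
    let ?E = "\<lambda>m \<omega>. R m \<omega> \<and> stays_above c m \<omega> (n - m) \<and> x + walk \<omega> (m + (n - m)) \<in> I"
    have "visit_prob K I n x \<le> (\<integral>\<^sup>+\<omega>. (\<Sum>m\<le>n. of_bool (?E m \<omega>)) \<partial>S)"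
      unfolding visit_prob_def
    proof (rule nn_integral_mono)
      fix \<omega>
      show "of_bool ((\<forall>i\<le>n. x + walk \<omega> i \<in> K) \<and> x + walk \<omega> n \<in> I) \<le> (\<Sum>m\<le>n. of_bool (?E m \<omega>) :: ennreal)"
      proof (cases "(\<forall>i\<le>n. x + walk \<omega> i \<in> K) \<and> x + walk \<omega> n \<in> I")
        case True
        obtain m where m: "m \<le> n" "\<forall>i<m. c * walk \<omega> m < c * walk \<omega> i" "\<forall>i\<le>n. c * walk \<omega> m \<le> c * walk \<omega> i"
          using exists_first_minimum[of n "\<lambda>i. c * walk \<omega> i"] by auto
        have "?E m \<omega>"
          using True m by (auto simp: R_def new_minimum_def stays_above_def)
        then have "(1::ennreal) = (\<Sum>m\<in>{m}. of_bool (?E m \<omega>))"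
          by simp
        also have "\<dots> \<le> (\<Sum>m\<le>n. of_bool (?E m \<omega>))"
          using m(1) by (intro sum_mono2) auto
        finally show ?thesis
          using True by simp
      qed (simp only: of_bool_eq(1) zero_le)
    qed
    also have "\<dots> = (\<Sum>m\<le>n. \<integral>\<^sup>+\<omega>. of_bool (?E m \<omega>) \<partial>S)"
      by (rule nn_integral_sum) measurable
    also have "\<dots> = (\<Sum>m\<le>n. \<integral>\<^sup>+\<omega>. of_bool (R m \<omega>) * D (n - m) (x + walk \<omega> m) \<partial>S)"
    proof (rule sum.cong)
      fix m
      have "(\<integral>\<^sup>+\<omega>. of_bool (?E m \<omega>) \<partial>S) = (\<integral>\<^sup>+\<omega>. \<integral>\<^sup>+\<omega>'. of_bool (?E m (comb_seq m \<omega> \<omega>')) \<partial>S \<partial>S)"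
        by (rule nn_integral_split_walk) measurable
      also have "\<dots> = (\<integral>\<^sup>+\<omega>. \<integral>\<^sup>+\<omega>'. of_bool (R m \<omega>) *
          of_bool (stays_above c 0 \<omega>' (n - m) \<and> walk \<omega>' (n - m) \<in> {y. x + walk \<omega> m + y \<in> I}) \<partial>S \<partial>S)"
        unfolding R_def
        by (intro nn_integral_cong)
          (simp add: new_minimum_def stays_above_def walk_comb_seq_add walk_comb_seq_le[of m m]
             walk_comb_seq_le[of _ m] distrib_left add.assoc of_bool_conj[symmetric] conj_ac)
      also have "\<dots> = (\<integral>\<^sup>+\<omega>. of_bool (R m \<omega>) * D (n - m) (x + walk \<omega> m) \<partial>S)"
        unfolding D_def by (intro nn_integral_cong nn_integral_cmult) measurable
      finally show "(\<integral>\<^sup>+\<omega>. of_bool (?E m \<omega>) \<partial>S) = (\<integral>\<^sup>+\<omega>. of_bool (R m \<omega>) * D (n - m) (x + walk \<omega> m) \<partial>S)" .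
    qed simp
    finally show ?thesis .
  qed
  then have "green K I x \<le> (\<Sum>n. \<Sum>m\<le>n. \<integral>\<^sup>+\<omega>. of_bool (R m \<omega>) * D (n - m) (x + walk \<omega> m) \<partial>S)"
    unfolding green_def by (intro suminf_le) auto
  also have "\<dots> \<le> (\<Sum>m. \<Sum>l. \<integral>\<^sup>+\<omega>. of_bool (R m \<omega>) * D l (x + walk \<omega> m) \<partial>S)"
    by (rule suminf_triangle_le)
  also have "\<dots> = (\<Sum>m. \<integral>\<^sup>+\<omega>. of_bool (R m \<omega>) * (\<Sum>l. D l (x + walk \<omega> m)) \<partial>S)"
    by (subst nn_integral_suminf[symmetric]) auto
  also have "\<dots> \<le> (\<Sum>m. \<integral>\<^sup>+\<omega>. of_bool (R m \<omega>) * B \<partial>S)"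
  proof (intro suminf_le nn_integral_mono mult_left_mono)
    fix \<omega> m
    have "(\<Sum>l. D l (x + walk \<omega> m)) = expected_records c {y. x + walk \<omega> m + y \<in> I}"
      unfolding D_def by (rule expected_stay_visits_eq_records) measurable
    then show "(\<Sum>l. D l (x + walk \<omega> m)) \<le> B"
      using B by simp
  qed auto
  also have "\<dots> = (\<Sum>m. \<integral>\<^sup>+\<omega>. of_bool (R m \<omega>) \<partial>S) * B"
    by (subst nn_integral_multc) auto
  finally show ?thesis
    unfolding R_def .
qed

lemma green_interval_le_split_at_minimum:
  fixes \<delta> b c :: real
  assumes [measurable]: "K \<in> sets borel"
  assumes c: "\<bar>c\<bar> = 1" and \<delta>: "\<delta> > 0" and p: "0 < measure \<nu> {y. \<delta> \<le> c * y}"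
  shows "green K {b..b + 1} x \<le>
    (\<Sum>m. \<integral>\<^sup>+\<omega>. of_bool (new_minimum c \<omega> m \<and> x + walk \<omega> m \<in> K) \<partial>S) *
    ennreal ((1 / \<delta> + 1) / measure \<nu> {y. \<delta> \<le> c * y})"
proof (rule green_le_split_at_minimum)
  fix z
  have "{y. z + y \<in> {b..b + 1}} = {b - z..b - z + 1}"
    by auto
  then show "expected_records c {y. z + y \<in> {b..b + 1}} \<le> ennreal ((1 / \<delta> + 1) / measure \<nu> {y. \<delta> \<le> c * y})"
    using expected_records_le[OF c \<delta> _ p, of 1 "b - z"] by simp
qed auto

text \<open>The new minima above \<open>a\<close> of a walk started at \<open>x\<close> are records of the mirrored walk in an interval
of length \<open>x - a\<close>, so there are \<open>O(1 + x - a)\<close> of them on average.\<close>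

theorem green_half_line_le:
  fixes \<delta> a b x :: real
  assumes \<delta>: "\<delta> > 0" and up: "0 < measure \<nu> {y. \<delta> \<le> y}" and down: "0 < measure \<nu> {y. y \<le> - \<delta>}"
    and x: "a \<le> x"
  shows "green {a..} {b..b + 1} x \<le>
    ennreal (((x - a) / \<delta> + 1) / measure \<nu> {y. y \<le> - \<delta>} * ((1 / \<delta> + 1) / measure \<nu> {y. \<delta> \<le> y}))"
proof -
  have "(\<Sum>m. \<integral>\<^sup>+\<omega>. of_bool (new_minimum 1 \<omega> m \<and> x + walk \<omega> m \<in> {a..}) \<partial>S) \<le>
      expected_records (-1) {a - x..a - x + (x - a)}"
    unfolding expected_records_def
  proof (intro suminf_le nn_integral_mono of_bool_mono impI)
    fix \<omega> m
    assume *: "new_minimum 1 \<omega> m \<and> x + walk \<omega> m \<in> {a..}"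
    then have "walk \<omega> m \<le> walk \<omega> i" if "i \<le> m" for i
      using that * by (cases "i = m") (auto simp: new_minimum_def intro: less_imp_le)
    from this this[of 0] * show "m \<in> record_steps \<omega> (-1) {a - x..a - x + (x - a)}"
      by (auto simp: record_steps_def weak_record_def)
  qed auto
  also have "\<dots> \<le> ennreal (((x - a) / \<delta> + 1) / measure \<nu> {y. \<delta> \<le> -1 * y})"
    using \<delta> x down by (intro expected_records_le) (auto simp: le_minus_iff)
  also have "{y. \<delta> \<le> -1 * y} = {y. y \<le> - \<delta>}"
    by auto
  finally have minima: "(\<Sum>m. \<integral>\<^sup>+\<omega>. of_bool (new_minimum 1 \<omega> m \<and> x + walk \<omega> m \<in> {a..}) \<partial>S) \<le>
      ennreal (((x - a) / \<delta> + 1) / measure \<nu> {y. y \<le> - \<delta>})" .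
  have "green {a..} {b..b + 1} x \<le> ennreal (((x - a) / \<delta> + 1) / measure \<nu> {y. y \<le> - \<delta>}) *
      ennreal ((1 / \<delta> + 1) / measure \<nu> {y. \<delta> \<le> 1 * y})"
    using \<delta> up by (intro order_trans[OF green_interval_le_split_at_minimum mult_right_mono[OF minima]]) auto
  then show ?thesis
    using \<delta> up down x by (subst ennreal_mult) auto
qed

text \<open>Here \<open>K\<close> is the whole line and the new minima have to be counted without a barrier. By time
reversal their expected number is at most the expected time that the walk spends in
\<open>c * z \<le> 0\<close> before leaving it. Wald's identity bounds that time: with steps truncated above at
\<open>M\<close> and mean drift \<open>d > 0\<close>, the function \<open>(M - c * z) / d\<close> decreases by at least one per step on
average and is nonnegative when the half-line is left, because the overshoot is at most \<open>M\<close>.\<close>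

theorem green_drift_le:
  fixes \<delta> M b c x :: real
  assumes c: "\<bar>c\<bar> = 1" and \<delta>: "\<delta> > 0" and p: "0 < measure \<nu> {y. \<delta> \<le> c * y}"
  assumes int: "integrable \<nu> (\<lambda>y. min (c * y) M)" and drift: "0 < (\<integral>y. min (c * y) M \<partial>\<nu>)"
  shows "green UNIV {b..b + 1} x \<le>
    ennreal (M / (\<integral>y. min (c * y) M \<partial>\<nu>) * ((1 / \<delta> + 1) / measure \<nu> {y. \<delta> \<le> c * y}))"
proof -
  define d where "d = (\<integral>y. min (c * y) M \<partial>\<nu>)"
  define \<psi> where "\<psi> z = of_bool (c * z \<le> 0) * ennreal ((M - c * z) / d)" for z
  have [measurable]: "\<psi> \<in> borel_measurable borel"
    unfolding \<psi>_def by measurable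
  have d: "d > 0"
    using drift by (simp add: d_def)
  have "d \<le> (\<integral>y. M \<partial>\<nu>)"
    unfolding d_def using int by (intro integral_mono) auto
  then have M: "M > 0"
    using d by simp
  have "(\<Sum>m. \<integral>\<^sup>+\<omega>. of_bool (new_minimum c \<omega> m \<and> x + walk \<omega> m \<in> UNIV) \<partial>S) \<le>
      green {z. c * z \<le> 0} UNIV 0"
    unfolding green_def visit_prob_def
  proof (rule suminf_le)
    fix m
    have "(\<integral>\<^sup>+\<omega>. of_bool (new_minimum c \<omega> m \<and> x + walk \<omega> m \<in> UNIV) \<partial>S) =
      (\<integral>\<^sup>+\<omega>. of_bool (new_minimum c (\<lambda>i. \<omega> (if i < m then m - Suc i else i)) m) \<partial>S)"
      by (subst nn_integral_reverse[where n = m]) auto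
    also have "\<dots> \<le> (\<integral>\<^sup>+\<omega>. of_bool ((\<forall>i\<le>m. 0 + walk \<omega> i \<in> {z. c * z \<le> 0}) \<and> 0 + walk \<omega> m \<in> UNIV) \<partial>S)"
    proof (intro nn_integral_mono of_bool_mono impI)
      fix \<omega>
      assume *: "new_minimum c (\<lambda>i. \<omega> (if i < m then m - Suc i else i)) m"
      have "c * walk \<omega> j \<le> 0" if "j \<le> m" for j
      proof (cases "j = 0")
        case False
        with that have "m - j < m" by simp
        with * have "c * (walk \<omega> m - walk \<omega> (m - m)) < c * (walk \<omega> m - walk \<omega> (m - (m - j)))"
          by (simp add: new_minimum_def walk_reverse)
        with that show ?thesis
          by (simp add: algebra_simps)
      qed simp
      then show "(\<forall>i\<le>m. 0 + walk \<omega> i \<in> {z. c * z \<le> 0}) \<and> 0 + walk \<omega> m \<in> UNIV"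
        by auto
    qed
    finally show "(\<integral>\<^sup>+\<omega>. of_bool (new_minimum c \<omega> m \<and> x + walk \<omega> m \<in> UNIV) \<partial>S) \<le>
      (\<integral>\<^sup>+\<omega>. of_bool ((\<forall>i\<le>m. 0 + walk \<omega> i \<in> {z. c * z \<le> 0}) \<and> 0 + walk \<omega> m \<in> UNIV) \<partial>S)" .
  qed auto
  also have "\<dots> \<le> \<psi> 0"
  proof (rule green_le_superharmonic)
    fix z
    assume z: "z \<in> {z. c * z \<le> 0}"
    have "(\<integral>\<^sup>+y. \<psi> (z + y) \<partial>\<nu>) \<le> (\<integral>\<^sup>+y. ennreal ((M - c * z - min (c * y) M) / d) \<partial>\<nu>)"
      using d z by (intro nn_integral_mono)
        (auto simp: \<psi>_def algebra_simps intro!: ennreal_leI divide_right_mono)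
    also have "\<dots> = ennreal (\<integral>y. (M - c * z - min (c * y) M) / d \<partial>\<nu>)"
      using d z int by (intro nn_integral_eq_integral) auto
    also have "(\<integral>y. (M - c * z - min (c * y) M) / d \<partial>\<nu>) = (M - c * z) / d - 1"
      using int d by (simp add: d_def[symmetric] diff_divide_distrib)
    finally have "of_bool (z \<in> UNIV) + (\<integral>\<^sup>+y. \<psi> (z + y) \<partial>\<nu>) \<le> 1 + ennreal ((M - c * z) / d - 1)"
      by (simp add: add_left_mono)
    also have "\<dots> = ennreal (1 + ((M - c * z) / d - 1))"
    proof -
      have "d \<le> M"
        using \<open>d \<le> (\<integral>y. M \<partial>\<nu>)\<close> by simp
      then have "0 \<le> (M - c * z) / d - 1"
        using z d by (simp add: field_simps)
      then show ?thesis
        by (subst ennreal_plus) auto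
    qed
    also have "\<dots> = \<psi> z"
      using z by (simp add: \<psi>_def)
    finally show "of_bool (z \<in> UNIV) + (\<integral>\<^sup>+y. \<psi> (z + y) \<partial>\<nu>) \<le> \<psi> z" .
  qed auto
  also have "\<psi> 0 = ennreal (M / d)"
    by (simp add: \<psi>_def)
  finally have minima: "(\<Sum>m. \<integral>\<^sup>+\<omega>. of_bool (new_minimum c \<omega> m \<and> x + walk \<omega> m \<in> UNIV) \<partial>S) \<le> ennreal (M / d)" .
  have "green UNIV {b..b + 1} x \<le> ennreal (M / d) * ennreal ((1 / \<delta> + 1) / measure \<nu> {y. \<delta> \<le> c * y})"
    using c \<delta> p by (intro order_trans[OF green_interval_le_split_at_minimum mult_right_mono[OF minima]]) auto
  then show ?thesis
    using \<delta> p d M by (subst ennreal_mult) (auto simp: d_def)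
qed

lemma ex_jump_bounded_below:
  assumes "0 < emeasure \<nu> {y. 0 < c * y}"
  shows "\<exists>\<delta>>0. 0 < measure \<nu> {y. \<delta> \<le> c * y}"
proof (rule ccontr)
  assume *: "\<not> (\<exists>\<delta>>0. 0 < measure \<nu> {y. \<delta> \<le> c * y})"
  have "emeasure \<nu> {y. 1 / real (Suc n) \<le> c * y} = 0" for n
  proof -
    have "0 < 1 / real (Suc n)" by simp
    with * have "\<not> 0 < measure \<nu> {y. 1 / real (Suc n) \<le> c * y}" by blast
    then show ?thesis
      by (simp add: emeasure_step not_less measure_le_0_iff)
  qed
  then have "emeasure \<nu> (\<Union>n. {y. 1 / real (Suc n) \<le> c * y}) = 0"
    by (intro emeasure_UN_eq_0) (auto simp: sets_step)
  also have "(\<Union>n. {y. 1 / real (Suc n) \<le> c * y}) = {y. 0 < c * y}"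
  proof safe
    fix y n assume "1 / real (Suc n) \<le> c * y"
    then show "0 < c * y" by (rule less_le_trans[rotated]) simp
  next
    fix y assume "0 < c * y"
    then obtain n where "1 / real (Suc n) < c * y"
      by (rule nat_approx_posE)
    then show "y \<in> (\<Union>n. {y. 1 / real (Suc n) \<le> c * y})"
      by (auto intro: less_imp_le)
  qed
  finally show False
    using assms by simp
qed

lemma green_cover_le:
  assumes [measurable]: "K \<in> sets borel" "I \<in> sets borel" "I1 \<in> sets borel" "I2 \<in> sets borel"
    and cover: "I \<subseteq> I1 \<union> I2"
  shows "green K I x \<le> green K I1 x + green K I2 x"
proof -
  have "visit_prob K I n x \<le> visit_prob K I1 n x + visit_prob K I2 n x" for n
    unfolding visit_prob_def
    by (subst nn_integral_add[symmetric]; (measurable)?; intro nn_integral_mono) (use cover in auto)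
  then have "green K I x \<le> (\<Sum>n. visit_prob K I1 n x + visit_prob K I2 n x)"
    unfolding green_def by (intro suminf_le) auto
  also have "\<dots> = green K I1 x + green K I2 x"
    unfolding green_def by (rule suminf_add[symmetric]) auto
  finally show ?thesis .
qed

end

text \<open>Grouping positions by absolute value lets all later series run over the natural numbers.\<close>

definition cell :: "nat \<Rightarrow> real set" where
  "cell j = {x. real j \<le> \<bar>x\<bar> \<and> \<bar>x\<bar> < real j + 1}"

lemma measurable_cell [measurable]: "cell j \<in> sets borel"
  unfolding cell_def by measurable

lemma in_cell_iff: "x \<in> cell j \<longleftrightarrow> nat \<lfloor>\<bar>x\<bar>\<rfloor> = j"
  unfolding cell_def mem_Collect_eq by linarith

context step_law
begin

lemma green_cell_le:
  assumes K: "K \<in> sets borel" and b: "\<And>b. green K {b..b + 1} x \<le> ennreal B" and "0 \<le> B"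
  shows "green K (cell j) x \<le> ennreal (2 * B)"
proof -
  have "green K (cell j) x \<le> green K {real j..real j + 1} x + green K {- real j - 1..- real j - 1 + 1} x"
    using K by (intro green_cover_le) (auto simp: cell_def)
  also have "\<dots> \<le> ennreal B + ennreal B"
    by (intro add_mono b)
  also have "\<dots> = ennreal (2 * B)"
    using \<open>0 \<le> B\<close> by (simp add: ennreal_plus[symmetric] del: ennreal_plus)
  finally show ?thesis .
qed

theorem green_cell_half_line_linear_growth:
  assumes up: "0 < emeasure \<nu> {y. 0 < y}" and down: "0 < emeasure \<nu> {y. y < 0}" and a: "a \<le> 0"
  shows "\<exists>C\<ge>1. \<forall>j x. a \<le> x \<longrightarrow> \<bar>x\<bar> \<le> real j + 1 \<longrightarrow> green {a..} (cell j) x \<le> ennreal (C * (1 + real j))"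
proof -
  obtain \<delta>1 where \<delta>1: "\<delta>1 > 0" "0 < measure \<nu> {y. \<delta>1 \<le> y}"
    using ex_jump_bounded_below[of 1] up by auto
  obtain \<delta>2 where \<delta>2: "\<delta>2 > 0" "0 < measure \<nu> {y. \<delta>2 \<le> - y}"
    using ex_jump_bounded_below[of "-1"] down by auto
  define \<delta> where "\<delta> = min \<delta>1 \<delta>2"
  have \<delta>: "\<delta> > 0"
    using \<delta>1 \<delta>2 by (simp add: \<delta>_def)
  have "measure \<nu> {y. \<delta>1 \<le> y} \<le> measure \<nu> {y. \<delta> \<le> y}"
    by (rule measure_step_mono) (auto simp: \<delta>_def)
  with \<delta>1 have p: "0 < measure \<nu> {y. \<delta> \<le> y}" by linarith
  have "measure \<nu> {y. \<delta>2 \<le> - y} \<le> measure \<nu> {y. y \<le> - \<delta>}"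
    by (rule measure_step_mono) (auto simp: \<delta>_def)
  with \<delta>2 have q: "0 < measure \<nu> {y. y \<le> - \<delta>}" by linarith
  define D where "D = (1 / \<delta> + 1) / measure \<nu> {y. \<delta> \<le> y}"
  define C where "C = 2 * (((1 - a) / \<delta> + 1) / measure \<nu> {y. y \<le> - \<delta>} * D)"
  have D: "D \<ge> 0" using \<delta> p by (simp add: D_def)
  have "green {a..} (cell j) x \<le> ennreal (max 1 C * (1 + real j))"
    if x: "a \<le> x" "\<bar>x\<bar> \<le> real j + 1" for j x
  proof -
    have "green {a..} (cell j) x \<le> ennreal (2 * (((x - a) / \<delta> + 1) / measure \<nu> {y. y \<le> - \<delta>} * D))"
      using green_half_line_le[OF \<delta> p q x(1)] \<delta> p q x D
      by (intro green_cell_le) (auto simp: D_def)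
    also have "2 * (((x - a) / \<delta> + 1) / measure \<nu> {y. y \<le> - \<delta>} * D) \<le>
        2 * (((1 - a) / \<delta> + 1) * (1 + real j) / measure \<nu> {y. y \<le> - \<delta>} * D)"
    proof -
      have "x - a \<le> (1 - a) * (1 + real j)"
        using x a mult_nonneg_nonneg[of "-a" "real j"] by (simp add: algebra_simps)
      then have "(x - a) / \<delta> + 1 \<le> (1 - a) * (1 + real j) / \<delta> + (1 + real j)"
        using \<delta> by (intro add_mono divide_right_mono) auto
      also have "\<dots> = ((1 - a) / \<delta> + 1) * (1 + real j)"
        by (simp add: algebra_simps)
      finally show ?thesis
        using D q by (intro mult_left_mono mult_right_mono divide_right_mono) auto
    qed
    also have "\<dots> = C * (1 + real j)"
      by (simp add: C_def)
    also have "\<dots> \<le> max 1 C * (1 + real j)"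
      by (intro mult_right_mono) auto
    finally show ?thesis
      by (simp add: ennreal_leI)
  qed
  then show ?thesis
    by (intro exI[of _ "max 1 C"]) auto
qed

theorem green_cell_drift_bounded:
  assumes c: "\<bar>c\<bar> = 1"
  assumes int: "integrable \<nu> (\<lambda>y. min (c * y) M)" and drift: "0 < (\<integral>y. min (c * y) M \<partial>\<nu>)"
  shows "\<exists>C\<ge>1. \<forall>j x. green UNIV (cell j) x \<le> ennreal C"
proof -
  have "0 < emeasure \<nu> {y. 0 < c * y}"
  proof (rule ccontr)
    assume "\<not> 0 < emeasure \<nu> {y. 0 < c * y}"
    then have "AE y in \<nu>. \<not> 0 < c * y"
      by (subst AE_iff_measurable[of "{y. 0 < c * y}"]) (auto simp: sets_step)
    then have "(\<integral>y. min (c * y) M \<partial>\<nu>) \<le> (\<integral>y. 0 \<partial>\<nu>)"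
      using int by (intro integral_mono_AE) auto
    with drift show False by simp
  qed
  then obtain \<delta> where \<delta>: "\<delta> > 0" "0 < measure \<nu> {y. \<delta> \<le> c * y}"
    using ex_jump_bounded_below by blast
  define B where "B = M / (\<integral>y. min (c * y) M \<partial>\<nu>) * ((1 / \<delta> + 1) / measure \<nu> {y. \<delta> \<le> c * y})"
  have "green UNIV (cell j) x \<le> ennreal (max 1 (2 * max 0 B))" for j x
  proof -
    have "green UNIV (cell j) x \<le> ennreal (2 * max 0 B)"
    proof (rule green_cell_le)
      show "green UNIV {b..b + 1} x \<le> ennreal (max 0 B)" for b
        using green_drift_le[OF c \<delta> int drift, of b x]
        by (rule order_trans) (auto simp: B_def intro!: ennreal_leI)
    qed auto
    also have "\<dots> \<le> ennreal (max 1 (2 * max 0 B))"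
      by (intro ennreal_leI) auto
    finally show ?thesis .
  qed
  then show ?thesis
    by (intro exI[of _ "max 1 (2 * max 0 B)"]) auto
qed

end

section \<open>Weighted sums over the tree\<close>

lemma (in prob_space) nn_integral_indep_pair:
  assumes ind: "indep_var S X T Y" and g [measurable]: "g \<in> borel_measurable (S \<Otimes>\<^sub>M T)"
  shows "(\<integral>\<^sup>+\<omega>. g (X \<omega>, Y \<omega>) \<partial>M) = (\<integral>\<^sup>+\<omega>. \<integral>\<^sup>+\<omega>'. g (X \<omega>, Y \<omega>') \<partial>M \<partial>M)"
proof -
  have [measurable]: "X \<in> M \<rightarrow>\<^sub>M S" "Y \<in> M \<rightarrow>\<^sub>M T"
    and D: "distr M S X \<Otimes>\<^sub>M distr M T Y = distr M (S \<Otimes>\<^sub>M T) (\<lambda>x. (X x, Y x))"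
    using ind by (auto simp: indep_var_distribution_eq)
  interpret Y: prob_space "distr M T Y"
    by (rule prob_space_distr) measurable
  have "(\<integral>\<^sup>+\<omega>. g (X \<omega>, Y \<omega>) \<partial>M) = (\<integral>\<^sup>+z. g z \<partial>(distr M S X \<Otimes>\<^sub>M distr M T Y))"
    unfolding D by (subst nn_integral_distr) auto
  also have "\<dots> = (\<integral>\<^sup>+x. \<integral>\<^sup>+y. g (x, y) \<partial>distr M T Y \<partial>distr M S X)"
    by (rule Y.nn_integral_fst[symmetric]) measurable
  also have "\<dots> = (\<integral>\<^sup>+x. \<integral>\<^sup>+\<omega>'. g (x, Y \<omega>') \<partial>M \<partial>distr M S X)"
    by (intro nn_integral_cong nn_integral_distr) auto
  also have "\<dots> = (\<integral>\<^sup>+\<omega>. \<integral>\<^sup>+\<omega>'. g (X \<omega>, Y \<omega>') \<partial>M \<partial>M)"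
    by (subst nn_integral_distr) auto
  finally show ?thesis .
qed

abbreviation tilted_law :: "real measure \<Rightarrow> real \<Rightarrow> real measure" where
  "tilted_law \<mu> t \<equiv> density \<mu> (\<lambda>x. ennreal (exp (- t * x)))"

lemma nn_integral_nonempty_lists:
  fixes h :: "'b list \<Rightarrow> ennreal"
  assumes "h [] = 0"
  shows "(\<integral>\<^sup>+v. h v \<partial>count_space UNIV) = (\<integral>\<^sup>+u. \<integral>\<^sup>+i. h (u @ [i]) \<partial>count_space UNIV \<partial>count_space UNIV)"
proof -
  have "(\<integral>\<^sup>+v. h v \<partial>count_space UNIV) = (\<integral>\<^sup>+v. h v \<partial>count_space {v. v \<noteq> []})"
    using assms by (intro nn_integral_count_space_eq) auto
  also have "\<dots> = (\<integral>\<^sup>+z. h ((\<lambda>(u, i). u @ [i]) z) \<partial>count_space UNIV)"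
  proof (rule nn_integral_bij_count_space[symmetric])
    show "bij_betw (\<lambda>(u, i). u @ [i]) UNIV {v :: 'b list. v \<noteq> []}"
      by (rule bij_betwI[where g = "\<lambda>v. (butlast v, last v)"]) auto
  qed
  also have "\<dots> = (\<integral>\<^sup>+u. \<integral>\<^sup>+i. h (u @ [i]) \<partial>count_space UNIV \<partial>count_space UNIV)"
    by (subst nn_integral_fst_count_space[symmetric]) simp
  finally show ?thesis .
qed

lemma in_tree_iff:
  "u \<in> tree L \<omega> \<longleftrightarrow> (\<forall>k<length u. enat (u ! k) < fst (L (take k u) \<omega>))"
proof (induction u rule: rev_induct)
  case (snoc i u)
  have "u @ [i] \<in> tree L \<omega> \<longleftrightarrow> u \<in> tree L \<omega> \<and> enat i < fst (L u \<omega>)"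
    by (auto intro: tree.intros elim: tree.cases)
  with snoc show ?case
    by (auto simp: nth_append less_Suc_eq)
qed (simp add: tree.root)

lemma take_in_tree: "u \<in> tree L \<omega> \<Longrightarrow> take i u \<in> tree L \<omega>"
  by (auto simp: in_tree_iff min_def)

text \<open>The basic functional of a particle: its exponential weight, multiplied by a factor \<open>q\<close> for every
strict ancestor. Killing is expressed by letting \<open>q\<close> vanish, and rewarding visits by letting \<open>q\<close>
exceed \<open>1\<close>.\<close>

definition path_weight ::
  "real \<Rightarrow> (real \<Rightarrow> ennreal) \<Rightarrow> (nat list \<Rightarrow> 'a \<Rightarrow> config) \<Rightarrow> 'a \<Rightarrow> nat list \<Rightarrow> ennreal" where
  "path_weight t q L \<omega> u = of_bool (u \<in> tree L \<omega>) * ennreal (exp (- t * position L \<omega> u)) *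
     (\<Prod>i<length u. q (position L \<omega> (take i u)))"

lemma path_weight_Nil [simp]: "path_weight t q L \<omega> [] = 1"
  by (simp add: path_weight_def tree.root position_root)

lemma path_weight_snoc:
  "path_weight t q L \<omega> (u @ [i]) = path_weight t q L \<omega> u * q (position L \<omega> u) *
     (of_bool (enat i < fst (L u \<omega>)) * ennreal (exp (- t * snd (L u \<omega>) i)))"
proof -
  have "u @ [i] \<in> tree L \<omega> \<longleftrightarrow> u \<in> tree L \<omega> \<and> enat i < fst (L u \<omega>)"
    by (auto intro: tree.intros elim: tree.cases)
  moreover have "exp (- t * (position L \<omega> u + snd (L u \<omega>) i)) =
      exp (- t * position L \<omega> u) * exp (- t * snd (L u \<omega>) i)"
    by (simp add: exp_add[symmetric] algebra_simps)
  ultimately show ?thesis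
    by (simp add: path_weight_def position_child ennreal_mult of_bool_conj mult_ac)
qed

context branching_random_walk
begin

lemma measurable_position [measurable]: "(\<lambda>\<omega>. position L \<omega> u) \<in> borel_measurable P"
  unfolding position_def by measurable

lemma measurable_path_weight [measurable]:
  assumes [measurable]: "q \<in> borel_measurable borel"
  shows "(\<lambda>\<omega>. path_weight t q L \<omega> u) \<in> borel_measurable P"
  unfolding path_weight_def by measurable

text \<open>Campbell's formula for the offspring point process of the root.\<close>

lemma nn_integral_intensity:
  assumes f [measurable]: "f \<in> borel_measurable borel"
  shows "(\<integral>\<^sup>+x. f x \<partial>intensity P L) =
    (\<integral>\<^sup>+\<omega>. (\<Sum>i. of_bool (enat i < fst (L [] \<omega>)) * f (snd (L [] \<omega>) i)) \<partial>P)"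
proof -
  let ?N = "P \<Otimes>\<^sub>M count_space (UNIV :: nat set)"
  let ?alive = "\<lambda>z. of_bool (enat (snd z) < fst (L [] (fst z))) :: ennreal"
  let ?pos = "\<lambda>z. snd (L [] (fst z)) (snd z)"
  \<comment> \<open>Written as an image measure, the intensity is open to Fubini and to a change of variables for all integrands at once.\<close>
  define N where "N = distr (density ?N ?alive) borel ?pos"
  interpret C: sigma_finite_measure "count_space (UNIV :: nat set)"
    by (rule sigma_finite_measure_count_space)
  have [measurable]: "?pos \<in> borel_measurable ?N"
    by (rule measurable_compose_countable[where g = snd]) measurable
  have [measurable]: "?alive \<in> borel_measurable ?N"
    by (rule measurable_compose_countable[where g = snd]) measurable
  have N: "(\<integral>\<^sup>+x. h x \<partial>N) = (\<integral>\<^sup>+\<omega>. (\<Sum>i. of_bool (enat i < fst (L [] \<omega>)) * h (snd (L [] \<omega>) i)) \<partial>P)"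
    if [measurable]: "h \<in> borel_measurable borel" for h :: "real \<Rightarrow> ennreal"
  proof -
    have "(\<integral>\<^sup>+x. h x \<partial>N) = (\<integral>\<^sup>+z. h (?pos z) \<partial>density ?N ?alive)"
      unfolding N_def by (rule nn_integral_distr) measurable
    also have "\<dots> = (\<integral>\<^sup>+z. ?alive z * h (?pos z) \<partial>?N)"
      by (rule nn_integral_density) measurable
    also have "\<dots> = (\<integral>\<^sup>+\<omega>. \<integral>\<^sup>+i. ?alive (\<omega>, i) * h (?pos (\<omega>, i)) \<partial>count_space UNIV \<partial>P)"
      by (rule C.nn_integral_fst[symmetric]) measurable
    finally show ?thesis
      by (simp add: nn_integral_count_space_nat)
  qed
  have "intensity P L = N"
  proof (rule measure_eqI)
    fix A assume "A \<in> sets (intensity P L)"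
    then have A [measurable]: "A \<in> sets borel" by simp
    have "emeasure N A = (\<integral>\<^sup>+x. indicator A x \<partial>N)"
      by (simp add: N_def)
    also have "\<dots> = emeasure (intensity P L) A"
      unfolding N[OF borel_measurable_indicator[OF A]] emeasure_intensity[OF A] emeasure_reproduction[OF A]
      by (intro nn_integral_cong suminf_cong) (auto simp: indicator_def)
    finally show "emeasure (intensity P L) A = emeasure N A" ..
  qed (simp add: N_def)
  then show ?thesis
    using N[OF f] by simp
qed

text \<open>One generation of the many-to-one formula. The weight and the position of \<open>u\<close> are functions of the
offspring of its strict ancestors, hence independent of the offspring of \<open>u\<close>; averaging over the
latter replaces the sum over children by one step of the walk with the tilted law.\<close>

lemma nn_integral_offspring_given_past:
  fixes u :: "nat list" and t :: real
  defines "\<nu> \<equiv> tilted_law (intensity P L) t"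
  assumes q [measurable]: "q \<in> borel_measurable borel" and \<psi> [measurable]: "\<psi> \<in> borel_measurable borel"
  shows "(\<Sum>i. \<integral>\<^sup>+\<omega>. path_weight t q L \<omega> (u @ [i]) * \<psi> (position L \<omega> (u @ [i])) \<partial>P) =
    (\<integral>\<^sup>+\<omega>. path_weight t q L \<omega> u * (q (position L \<omega> u) * (\<integral>\<^sup>+y. \<psi> (position L \<omega> u + y) \<partial>\<nu>)) \<partial>P)"
proof -
  \<comment> \<open>The strict ancestors of \<open>u\<close>, on whose offspring alone everything about \<open>u\<close> depends; \<open>?can\<close> reads the tree off a family of configurations.\<close>
  define A where "A = {take k u |k. k < length u}"
  have takeA [simp]: "k < length u \<Longrightarrow> take k u \<in> A" for k
    by (auto simp: A_def)
  have uA: "u \<notin> A"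
    by (auto simp: A_def) (metis length_take less_irrefl min.absorb4)
  let ?X = "\<lambda>\<omega>. restrict (\<lambda>v. L v \<omega>) A"
  let ?can = "\<lambda>v (l :: nat list \<Rightarrow> config). l v"
  have position_X: "position ?can (?X \<omega>) (take i u) = position L \<omega> (take i u)" for i \<omega>
    by (auto simp: position_def intro!: sum.cong)
  have weight_X: "path_weight t q ?can (?X \<omega>) u = path_weight t q L \<omega> u" for \<omega>
    using position_X[of \<omega> "length u"]
    by (simp add: path_weight_def position_X in_tree_iff)
  have comp [measurable]: "(\<lambda>l. l v) \<in> (\<Pi>\<^sub>M v\<in>A. config_space) \<rightarrow>\<^sub>M config_space" if "v \<in> A" for v
    by (rule measurable_component_singleton[OF that])
  have comp_fst: "(\<lambda>l. fst (l v)) \<in> (\<Pi>\<^sub>M v\<in>A. config_space) \<rightarrow>\<^sub>M count_space UNIV" if "v \<in> A" for v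
    using comp[OF that] unfolding config_space_def by measurable
  have [measurable]: "(\<lambda>c. snd c i) \<in> borel_measurable config_space" for i :: nat
    unfolding config_space_def by measurable
  have [measurable]: "(\<lambda>c. fst c) \<in> config_space \<rightarrow>\<^sub>M count_space UNIV"
    unfolding config_space_def by measurable
  have pos_can [measurable]: "(\<lambda>l. position ?can l (take i u)) \<in> borel_measurable (\<Pi>\<^sub>M v\<in>A. config_space)" for i
  proof -
    have "(\<lambda>l. snd (l (take k (take i u))) (take i u ! k)) \<in> borel_measurable (\<Pi>\<^sub>M v\<in>A. config_space)"
      if "k < length (take i u)" for k
      using that by (intro measurable_compose[OF comp]) auto
    then show ?thesis
      unfolding position_def by (intro borel_measurable_sum) auto
  qed
  have pos_can' [measurable]: "(\<lambda>l. position ?can l u) \<in> borel_measurable (\<Pi>\<^sub>M v\<in>A. config_space)"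
    using pos_can[of "length u"] by simp
  have "Measurable.pred (\<Pi>\<^sub>M v\<in>A. config_space) (\<lambda>l. \<forall>k<length u. enat (u ! k) < fst (l (take k u)))"
  proof -
    have "Measurable.pred (\<Pi>\<^sub>M v\<in>A. config_space) (\<lambda>l. k < length u \<longrightarrow> enat (u ! k) < fst (l (take k u)))" for k
    proof (cases "k < length u")
      case True
      then show ?thesis
        using measurable_compose[OF comp_fst[OF takeA[OF True]], of "\<lambda>n. enat (u ! k) < n" "count_space UNIV"]
        by simp
    qed simp
    then show ?thesis
      by (rule pred_intros_countable)
  qed
  then have [measurable]: "Measurable.pred (\<Pi>\<^sub>M v\<in>A. config_space) (\<lambda>l. u \<in> tree ?can l)"
    by (simp add: in_tree_iff)
  have [measurable]: "(\<lambda>l. path_weight t q ?can l u) \<in> borel_measurable (\<Pi>\<^sub>M v\<in>A. config_space)"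
    unfolding path_weight_def by measurable
  let ?Y = "\<lambda>\<omega>. restrict (\<lambda>v. L v \<omega>) {u}"
  have [measurable]: "(\<lambda>l. l u) \<in> (\<Pi>\<^sub>M v\<in>{u}. config_space) \<rightarrow>\<^sub>M config_space"
    by (rule measurable_component_singleton) simp
  define g where "g i z = path_weight t q ?can (fst z) u * q (position ?can (fst z) u) *
      (of_bool (enat i < fst (snd z u)) * ennreal (exp (- t * snd (snd z u) i))) *
      \<psi> (position ?can (fst z) u + snd (snd z u) i)" for i :: nat and z :: "(nat list \<Rightarrow> config) \<times> (nat list \<Rightarrow> config)"
  have g [measurable]: "g i \<in> borel_measurable ((\<Pi>\<^sub>M v\<in>A. config_space) \<Otimes>\<^sub>M (\<Pi>\<^sub>M v\<in>{u}. config_space))" for i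
    unfolding g_def by measurable
  have ind: "indep_var (\<Pi>\<^sub>M v\<in>A. config_space) ?X (\<Pi>\<^sub>M v\<in>{u}. config_space) ?Y"
    using uA by (intro indep_var_restrict[OF indep]) auto
  have [measurable]: "?Y \<in> P \<rightarrow>\<^sub>M (\<Pi>\<^sub>M v\<in>{u}. config_space)"
    by (rule measurable_restrict) measurable
  have X_space: "?X \<omega> \<in> space (\<Pi>\<^sub>M v\<in>A. config_space)" for \<omega>
    by (auto simp: space_PiM config_space_def space_pair_measure)
  have [measurable]: "?X \<in> P \<rightarrow>\<^sub>M (\<Pi>\<^sub>M v\<in>A. config_space)"
    by (rule measurable_restrict) measurable
  have inner: "(\<lambda>\<omega>'. g i (?X \<omega>, ?Y \<omega>')) \<in> borel_measurable P" for i \<omega>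
    using X_space by (intro measurable_compose[OF _ g] measurable_Pair measurable_const) auto
  have outer: "(\<lambda>\<omega>. \<integral>\<^sup>+\<omega>'. g i (?X \<omega>, ?Y \<omega>') \<partial>P) \<in> borel_measurable P" for i
    by measurable
  have "(\<Sum>i. \<integral>\<^sup>+\<omega>. path_weight t q L \<omega> (u @ [i]) * \<psi> (position L \<omega> (u @ [i])) \<partial>P) =
      (\<Sum>i. \<integral>\<^sup>+\<omega>. g i (?X \<omega>, ?Y \<omega>) \<partial>P)"
    using position_X[of _ "length u"]
    by (simp add: g_def weight_X path_weight_snoc position_child)
  also have "\<dots> = (\<Sum>i. \<integral>\<^sup>+\<omega>. \<integral>\<^sup>+\<omega>'. g i (?X \<omega>, ?Y \<omega>') \<partial>P \<partial>P)"
    by (intro suminf_cong nn_integral_indep_pair[OF ind g])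
  also have "\<dots> = (\<integral>\<^sup>+\<omega>. \<integral>\<^sup>+\<omega>'. (\<Sum>i. g i (?X \<omega>, ?Y \<omega>')) \<partial>P \<partial>P)"
    by (simp add: nn_integral_suminf inner outer)
  also have "\<dots> = (\<integral>\<^sup>+\<omega>. path_weight t q L \<omega> u * (q (position L \<omega> u) * (\<integral>\<^sup>+y. \<psi> (position L \<omega> u + y) \<partial>\<nu>)) \<partial>P)"
  proof (rule nn_integral_cong)
    fix \<omega>
    let ?w = "path_weight t q L \<omega> u * q (position L \<omega> u)" and ?V = "position L \<omega> u"
    let ?h = "\<lambda>c. \<Sum>i. of_bool (enat i < fst c) * (ennreal (exp (- t * snd c i)) * \<psi> (?V + snd c i))"
    have h [measurable]: "?h \<in> borel_measurable config_space"
      by measurable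
    have "(\<integral>\<^sup>+\<omega>'. (\<Sum>i. g i (?X \<omega>, ?Y \<omega>')) \<partial>P) = (\<integral>\<^sup>+\<omega>'. ?w * ?h (L u \<omega>') \<partial>P)"
      using position_X[of \<omega> "length u"]
      by (simp add: g_def weight_X mult.assoc ennreal_suminf_cmult)
    also have "\<dots> = ?w * (\<integral>\<^sup>+\<omega>'. ?h (L u \<omega>') \<partial>P)"
      by (rule nn_integral_cmult) measurable
    also have "(\<integral>\<^sup>+\<omega>'. ?h (L u \<omega>') \<partial>P) = (\<integral>\<^sup>+c. ?h c \<partial>distr P config_space (L u))"
      by (rule nn_integral_distr[symmetric]) (simp_all add: h)
    also have "\<dots> = (\<integral>\<^sup>+\<omega>'. ?h (L [] \<omega>') \<partial>P)"
      unfolding identically_distributed[of u] by (rule nn_integral_distr) (simp_all add: h)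
    also have "\<dots> = (\<integral>\<^sup>+y. ennreal (exp (- t * y)) * \<psi> (?V + y) \<partial>intensity P L)"
      by (rule nn_integral_intensity[symmetric]) measurable
    also have "\<dots> = (\<integral>\<^sup>+y. \<psi> (?V + y) \<partial>\<nu>)"
      unfolding \<nu>_def by (rule nn_integral_density[symmetric]) measurable
    finally show "(\<integral>\<^sup>+\<omega>'. (\<Sum>i. g i (?X \<omega>, ?Y \<omega>')) \<partial>P) =
        path_weight t q L \<omega> u * (q ?V * (\<integral>\<^sup>+y. \<psi> (?V + y) \<partial>\<nu>))"
      by (simp only: mult.assoc)
  qed
  finally show ?thesis .
qed

definition level_sum :: "real \<Rightarrow> (real \<Rightarrow> ennreal) \<Rightarrow> (real \<Rightarrow> ennreal) \<Rightarrow> nat \<Rightarrow> ennreal" where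
  "level_sum t q f n = (\<integral>\<^sup>+u. of_bool (length u = n) *
     (\<integral>\<^sup>+\<omega>. path_weight t q L \<omega> u * f (position L \<omega> u) \<partial>P) \<partial>count_space UNIV)"

lemma level_sum_0: "level_sum t q f 0 = f 0"
proof -
  have "level_sum t q f 0 = (\<integral>\<^sup>+u. f 0 * indicator {[]} u \<partial>count_space (UNIV :: nat list set))"
    unfolding level_sum_def
    by (intro nn_integral_cong) (auto simp: indicator_def position_root emeasure_space_1)
  also have "\<dots> = f 0"
    by (subst nn_integral_cmult_indicator) auto
  finally show ?thesis .
qed

lemma level_sum_Suc:
  fixes t :: real
  defines "\<nu> \<equiv> tilted_law (intensity P L) t"
  assumes [measurable]: "q \<in> borel_measurable borel" "\<psi> \<in> borel_measurable borel"
  shows "level_sum t q \<psi> (Suc n) = level_sum t q (\<lambda>x. q x * (\<integral>\<^sup>+y. \<psi> (x + y) \<partial>\<nu>)) n"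
proof -
  have "level_sum t q \<psi> (Suc n) = (\<integral>\<^sup>+u. \<integral>\<^sup>+i. of_bool (length (u @ [i]) = Suc n) *
     (\<integral>\<^sup>+\<omega>. path_weight t q L \<omega> (u @ [i]) * \<psi> (position L \<omega> (u @ [i])) \<partial>P)
      \<partial>count_space UNIV \<partial>count_space UNIV)"
    unfolding level_sum_def by (rule nn_integral_nonempty_lists) simp
  also have "\<dots> = level_sum t q (\<lambda>x. q x * (\<integral>\<^sup>+y. \<psi> (x + y) \<partial>\<nu>)) n"
    unfolding level_sum_def \<nu>_def
    by (intro nn_integral_cong)
      (simp add: nn_integral_count_space_nat ennreal_suminf_cmult nn_integral_offspring_given_past)
  finally show ?thesis .
qed

text \<open>Discrete potential theory on the tree. By the one-generation formula, the reward \<open>r\<close> collected before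
generation \<open>N\<close> plus the potential \<open>\<psi>\<close> carried by generation \<open>N\<close> decreases in \<open>N\<close>, so the total
expected reward is at most the potential of the root. Every probabilistic estimate for the
branching random walk below is an instance with suitable \<open>q\<close>, \<open>r\<close> and \<open>\<psi>\<close>.\<close>

lemma nn_integral_path_weight_le:
  fixes t :: real
  defines "\<nu> \<equiv> tilted_law (intensity P L) t"
  assumes meas [measurable]: "q \<in> borel_measurable borel" "r \<in> borel_measurable borel" "\<psi> \<in> borel_measurable borel"
  assumes law: "step_law \<nu>"
    and super: "\<And>x. r x + q x * (\<integral>\<^sup>+y. \<psi> (x + y) \<partial>\<nu>) \<le> \<psi> x"
  shows "(\<integral>\<^sup>+\<omega>. \<integral>\<^sup>+u. path_weight t q L \<omega> u * r (position L \<omega> u) \<partial>count_space UNIV \<partial>P) \<le> \<psi> 0"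
proof -
  interpret \<nu>: step_law \<nu>
    by fact
  have [measurable]: "(\<lambda>x. \<integral>\<^sup>+y. \<psi> (x + y) \<partial>\<nu>) \<in> borel_measurable borel"
    by measurable
  have partial: "(\<Sum>n<N. level_sum t q r n) + level_sum t q \<psi> N \<le> \<psi> 0" for N
  proof (induction N)
    case (Suc N)
    have "level_sum t q r N + level_sum t q \<psi> (Suc N) =
        level_sum t q r N + level_sum t q (\<lambda>x. q x * (\<integral>\<^sup>+y. \<psi> (x + y) \<partial>\<nu>)) N"
      unfolding \<nu>_def by (subst level_sum_Suc) auto
    also have "\<dots> = level_sum t q (\<lambda>x. r x + q x * (\<integral>\<^sup>+y. \<psi> (x + y) \<partial>\<nu>)) N"
      unfolding level_sum_def
      by (subst nn_integral_add[symmetric])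
        (auto simp: distrib_left nn_integral_add intro!: nn_integral_cong)
    also have "\<dots> \<le> level_sum t q \<psi> N"
      unfolding level_sum_def by (intro nn_integral_mono mult_left_mono super) auto
    finally have "(\<Sum>n<N. level_sum t q r n) + (level_sum t q r N + level_sum t q \<psi> (Suc N)) \<le>
        (\<Sum>n<N. level_sum t q r n) + level_sum t q \<psi> N"
      by (rule add_left_mono)
    from order_trans[OF this Suc] show ?case
      by (simp add: add.assoc)
  qed (simp add: level_sum_0)
  have "(\<integral>\<^sup>+\<omega>. \<integral>\<^sup>+u. path_weight t q L \<omega> u * r (position L \<omega> u) \<partial>count_space UNIV \<partial>P) =
      (\<integral>\<^sup>+u. \<integral>\<^sup>+\<omega>. path_weight t q L \<omega> u * r (position L \<omega> u) \<partial>P \<partial>count_space UNIV)"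
    by (rule nn_integral_count_space_nn_integral) auto
  also have "\<dots> = (\<integral>\<^sup>+u. (\<Sum>n. of_bool (length u = n) *
      (\<integral>\<^sup>+\<omega>. path_weight t q L \<omega> u * r (position L \<omega> u) \<partial>P)) \<partial>count_space UNIV)"
  proof (rule nn_integral_cong)
    fix u :: "nat list"
    have "(\<Sum>n. of_bool (length u = n) * c) = (\<Sum>n\<in>{length u}. of_bool (length u = n) * c)" for c :: ennreal
      by (rule suminf_finite) auto
    then show "(\<integral>\<^sup>+\<omega>. path_weight t q L \<omega> u * r (position L \<omega> u) \<partial>P) = (\<Sum>n. of_bool (length u = n) *
      (\<integral>\<^sup>+\<omega>. path_weight t q L \<omega> u * r (position L \<omega> u) \<partial>P))"
      by simp
  qed
  also have "\<dots> = (\<Sum>n. level_sum t q r n)"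
    unfolding level_sum_def by (rule nn_integral_suminf) auto
  also have "\<dots> \<le> \<psi> 0"
  proof (rule suminf_le_const)
    show "(\<Sum>n<N. level_sum t q r n) \<le> \<psi> 0" for N
      by (rule order_trans[OF add_increasing2[OF zero_le order_refl] partial])
  qed simp
  finally show ?thesis .
qed

end

section \<open>The lowest position and the number of visits\<close>

lemma exp_le_power_one_plus:
  assumes "0 \<le> y" "y \<le> (1::real)"
  shows "exp (real n * (y / 2)) \<le> (1 + y) ^ n"
proof -
  have "exp (y / 2) \<le> 1 + y / 2 + (y / 2)\<^sup>2"
    using assms by (intro exp_bound) auto
  also have "(y / 2)\<^sup>2 \<le> y / 2"
    using assms mult_left_mono[of "y / 2" 1 "y / 2"] by (simp add: power2_eq_square)
  finally have "exp (y / 2) \<le> 1 + y" by simp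
  then have "exp (y / 2) ^ n \<le> (1 + y) ^ n"
    by (intro power_mono) auto
  then show ?thesis
    by (simp only: exp_of_nat_mult)
qed

lemma borel_measurable_nn_integral_count_space:
  fixes f :: "'i::countable \<Rightarrow> 'b \<Rightarrow> ennreal"
  assumes [measurable]: "\<And>u. f u \<in> borel_measurable M"
  shows "(\<lambda>\<omega>. \<integral>\<^sup>+u. f u \<omega> \<partial>count_space UNIV) \<in> borel_measurable M"
proof -
  interpret C: sigma_finite_measure "count_space (UNIV :: 'i set)"
    by (rule sigma_finite_measure_count_space)
  have "(\<lambda>z. f (snd z) (fst z)) \<in> borel_measurable (M \<Otimes>\<^sub>M count_space UNIV)"
    by (rule measurable_compose_countable[where g = snd]) measurable
  then show ?thesis
    by (intro C.borel_measurable_nn_integral) (simp add: case_prod_beta')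
qed

definition visits_before :: "(nat list \<Rightarrow> 'a \<Rightarrow> config) \<Rightarrow> 'a \<Rightarrow> nat \<Rightarrow> nat list \<Rightarrow> nat" where
  "visits_before L \<omega> j u = card {i. i < length u \<and> position L \<omega> (take i u) \<in> cell j}"

context branching_random_walk
begin

text \<open>The expected weight of the particles that are the first on their ancestral line below \<open>-A\<close> is at
most one, as the constant \<open>1\<close> is harmonic for a probability law. Each of them weighs at least
\<open>exp (t * A)\<close>, so with probability at least \<open>1 - exp (- t * A)\<close> there are none.\<close>

lemma AE_positions_bounded_below:
  fixes t :: real
  assumes t: "t > 0" and law: "step_law (tilted_law (intensity P L) t)"
  shows "AE \<omega> in P. \<exists>A::nat. \<forall>u\<in>tree L \<omega>. - real A \<le> position L \<omega> u"
proof -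
  let ?\<nu> = "tilted_law (intensity P L) t"
  interpret \<nu>: step_law ?\<nu>
    by (rule law)
  define bad where "bad A = {\<omega>\<in>space P. \<exists>u. u \<in> tree L \<omega> \<and> position L \<omega> u < - real A}" for A
  have [measurable]: "bad A \<in> sets P" for A
    unfolding bad_def by measurable
  have bound: "emeasure P (bad A) \<le> ennreal (exp (- t * real A))" for A
  proof -
    let ?q = "\<lambda>x. of_bool (- real A \<le> x) :: ennreal" and ?r = "\<lambda>x. of_bool (x < - real A) :: ennreal"
    let ?Z = "\<lambda>\<omega>. \<integral>\<^sup>+u. path_weight t ?q L \<omega> u * ?r (position L \<omega> u) \<partial>count_space UNIV"
    have Z: "(\<integral>\<^sup>+\<omega>. ?Z \<omega> \<partial>P) \<le> 1"
    proof (rule nn_integral_path_weight_le[where \<psi> = "\<lambda>_. 1"])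
      show "?r x + ?q x * (\<integral>\<^sup>+y. 1 \<partial>?\<nu>) \<le> 1" for x
        using prob_space.emeasure_space_1[OF \<nu>.prob_space_step] by (cases "x < - real A") auto
    qed (use law in auto)
    have "emeasure P (bad A) = (\<integral>\<^sup>+\<omega>. indicator (bad A) \<omega> \<partial>P)"
      by simp
    also have "\<dots> \<le> (\<integral>\<^sup>+\<omega>. ennreal (exp (- t * real A)) * ?Z \<omega> \<partial>P)"
    proof (rule nn_integral_mono)
      fix \<omega>
      show "indicator (bad A) \<omega> \<le> ennreal (exp (- t * real A)) * ?Z \<omega>"
      proof (cases "\<omega> \<in> bad A")
        case True
        then obtain u where u: "u \<in> tree L \<omega>" "position L \<omega> u < - real A"
          by (auto simp: bad_def)
        define k where "k = (LEAST k. position L \<omega> (take k u) < - real A)"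
        have k: "position L \<omega> (take k u) < - real A"
          unfolding k_def by (rule LeastI[of _ "length u"]) (use u in simp)
        have before: "- real A \<le> position L \<omega> (take i u)" if "i < k" for i
          using not_less_Least[OF that[unfolded k_def]] by simp
        have "ennreal (exp (t * real A)) \<le> ennreal (exp (- t * position L \<omega> (take k u)))"
        proof (intro ennreal_leI)
          have "t * real A \<le> t * (- position L \<omega> (take k u))"
            using t k by (intro mult_left_mono) auto
          then show "exp (t * real A) \<le> exp (- t * position L \<omega> (take k u))"
            by simp
        qed
        also have "\<dots> = path_weight t ?q L \<omega> (take k u) * ?r (position L \<omega> (take k u))"
          using take_in_tree[OF u(1)] k before by (simp add: path_weight_def min_def)
        also have "\<dots> \<le> ?Z \<omega>"
          by (rule nn_integral_ge_point) simp
        finally have "ennreal (exp (- t * real A)) * ennreal (exp (t * real A)) \<le> ennreal (exp (- t * real A)) * ?Z \<omega>"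
          by (rule mult_left_mono) simp
        also have "ennreal (exp (- t * real A)) * ennreal (exp (t * real A)) = 1"
          by (simp add: ennreal_mult[symmetric] exp_add[symmetric])
        finally show ?thesis
          using True by simp
      qed simp
    qed
    also have "\<dots> = ennreal (exp (- t * real A)) * (\<integral>\<^sup>+\<omega>. ?Z \<omega> \<partial>P)"
      by (intro nn_integral_cmult borel_measurable_nn_integral_count_space) measurable
    also have "\<dots> \<le> ennreal (exp (- t * real A)) * 1"
      by (intro mult_left_mono Z) simp
    finally show ?thesis by simp
  qed
  have "(\<lambda>A. exp (- t * real A)) \<longlonglongrightarrow> 0"
  proof -
    have "(\<lambda>A. exp (- t) ^ A) \<longlonglongrightarrow> 0"
      using t by (intro LIMSEQ_power_zero) auto
    then show ?thesis
      by (simp add: exp_of_nat_mult[symmetric] mult.commute)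
  qed
  then have lim: "(\<lambda>A. ennreal (exp (- t * real A))) \<longlonglongrightarrow> 0"
    using tendsto_ennrealI by fastforce
  have "emeasure P (\<Inter>A. bad A) \<le> ennreal (exp (- t * real A))" for A
    using emeasure_mono[of "\<Inter>A. bad A" "bad A" P] bound[of A] by (meson INT_lower UNIV_I order_trans \<open>\<And>A. bad A \<in> sets P\<close>)
  then have "emeasure P (\<Inter>A. bad A) \<le> 0"
    by (intro LIMSEQ_le_const[OF lim]) auto
  then have "AE \<omega> in P. \<omega> \<notin> (\<Inter>A. bad A)"
    by (intro AE_not_in null_setsI) auto
  then show ?thesis
    using AE_space
  proof eventually_elim
    case (elim \<omega>)
    then show ?case
      by (auto simp: bad_def not_less)
  qed
qed

text \<open>Rewarding every visit by a factor \<open>1 + 1 / (2 * g)\<close> at most doubles the potential: on the cell the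
Green function drops by one in a step and is at most \<open>g\<close>, so \<open>2 * green\<close> drops by two, of which one
pays for the visit and one for the factor applied to the remaining potential of size at most
\<open>2 * g\<close>. This yields an exponential moment for the number of visits without iterating the strong
Markov property.\<close>

lemma expected_cell_visits_le:
  fixes t g :: real
  defines "\<nu> \<equiv> tilted_law (intensity P L) t"
  assumes law: "step_law \<nu>" and K [measurable]: "K \<in> sets borel" and g: "1 \<le> g"
    and green: "\<And>x. x \<in> cell j \<Longrightarrow> x \<in> K \<Longrightarrow> step_law.green \<nu> K (cell j) x \<le> ennreal g"
  shows "(\<integral>\<^sup>+\<omega>. \<integral>\<^sup>+u. path_weight t (\<lambda>x. of_bool (x \<in> K) * ennreal (1 + of_bool (x \<in> cell j) / (2 * g))) L \<omega> u *
      of_bool (position L \<omega> u \<in> K \<and> position L \<omega> u \<in> cell j) \<partial>count_space UNIV \<partial>P)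
    \<le> 2 * step_law.green \<nu> K (cell j) 0"
proof -
  interpret \<nu>: step_law \<nu>
    by (rule law)
  let ?G = "\<nu>.green K (cell j)"
  have [measurable]: "?G \<in> borel_measurable borel"
    by (rule \<nu>.measurable_green) auto
  have \<psi>: "(\<lambda>x. 2 * ?G x) \<in> borel_measurable borel"
    by measurable
  show ?thesis
    unfolding \<nu>_def
  proof (rule nn_integral_path_weight_le[OF _ _ \<psi>[unfolded \<nu>_def] law[unfolded \<nu>_def]])
    fix x
    let ?I = "\<integral>\<^sup>+y. ?G (x + y) \<partial>\<nu>"
    have I2: "(\<integral>\<^sup>+y. 2 * ?G (x + y) \<partial>\<nu>) = 2 * ?I"
      by (rule nn_integral_cmult) measurable
    have eq: "?G x = of_bool (x \<in> K) * (of_bool (x \<in> cell j) + ?I)"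
      by (rule \<nu>.green_eq) auto
    have "of_bool (x \<in> K \<and> x \<in> cell j) + of_bool (x \<in> K) * ennreal (1 + of_bool (x \<in> cell j) / (2 * g)) * (2 * ?I) \<le> 2 * ?G x"
    proof (cases "x \<in> K \<and> x \<in> cell j")
      case True
      then have G: "?G x = 1 + ?I"
        using eq by simp
      have "?I \<le> 1 + ?I"
        by (rule add_increasing) simp_all
      also have "\<dots> \<le> ennreal g"
        using green[of x] True G by simp
      finally have "?I \<le> ennreal g" .
      then have "ennreal (1 / (2 * g)) * (2 * ?I) \<le> ennreal (1 / (2 * g)) * (2 * ennreal g)"
        by (intro mult_left_mono) auto
      also have "2 * ennreal g = ennreal (2 * g)"
        using g by (simp add: ennreal_mult)
      also have "ennreal (1 / (2 * g)) * ennreal (2 * g) = 1"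
        using g by (simp add: ennreal_mult[symmetric])
      finally have "ennreal (1 / (2 * g)) * (2 * ?I) \<le> 1" .
      moreover have "ennreal (1 + 1 / (2 * g)) = 1 + ennreal (1 / (2 * g))"
        using g by (subst ennreal_plus) auto
      ultimately have "1 + ennreal (1 + 1 / (2 * g)) * (2 * ?I) \<le> 1 + (2 * ?I + 1)"
        by (simp add: distrib_right add_left_mono)
      also have "\<dots> = 2 * ?G x"
        unfolding G by (simp add: distrib_left add_ac)
      finally show ?thesis
        using True by simp
    next
      case False
      then show ?thesis
        using eq by (cases "x \<in> K") auto
    qed
    then show "of_bool (x \<in> K \<and> x \<in> cell j) + of_bool (x \<in> K) * ennreal (1 + of_bool (x \<in> cell j) / (2 * g)) *
        (\<integral>\<^sup>+y. 2 * step_law.green (tilted_law (intensity P L) t) K (cell j) (x + y)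
          \<partial>tilted_law (intensity P L) t)
      \<le> 2 * step_law.green (tilted_law (intensity P L) t) K (cell j) x"
      using I2 unfolding \<nu>_def by simp
  qed measurable
qed

text \<open>Summing the exponential moments over all cells with summable weights gives a single random variable
\<open>Z\<close> that is almost surely finite. A particle in cell \<open>j\<close> weighs at least \<open>exp (- t * (j + 1))\<close>, so
its reward \<open>(1 + 1 / (2 * g j)) ^ N\<close> is at most \<open>Z\<close> times a factor of order \<open>exp (O(j))\<close>. Taking
logarithms, the number \<open>N\<close> of visits is \<open>O(j * g j)\<close>, simultaneously for all particles.\<close>

theorem AE_visits_polynomial:
  fixes t C :: real and d :: nat
  defines "\<nu> \<equiv> tilted_law (intensity P L) t"
  assumes t: "t > 0" and law: "step_law \<nu>" and K [measurable]: "K \<in> sets borel" and C: "1 \<le> C"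
    and green: "\<And>j x. x \<in> K \<Longrightarrow> \<bar>x\<bar> \<le> real j + 1 \<Longrightarrow>
      step_law.green \<nu> K (cell j) x \<le> ennreal (C * (1 + real j) ^ d)"
  shows "AE \<omega> in P. (\<forall>u\<in>tree L \<omega>. position L \<omega> u \<in> K) \<longrightarrow>
    (\<exists>B\<ge>0. \<forall>j. \<forall>u\<in>tree L \<omega>. position L \<omega> u \<in> cell j \<longrightarrow>
      real (visits_before L \<omega> j u) \<le> B * (1 + real j) ^ Suc d)"
proof -
  interpret \<nu>: step_law \<nu>
    by (rule law)
  define g where "g j = C * (1 + real j) ^ d" for j
  have g: "1 \<le> g j" for j
    unfolding g_def using C by (intro mult_ge1_I one_le_power) auto
  define q where "q j x = (of_bool (x \<in> K) * ennreal (1 + of_bool (x \<in> cell j) / (2 * g j)))" for j x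
  have [measurable]: "q j \<in> borel_measurable borel" for j
    unfolding q_def by measurable
  define V where "V j \<omega> = (\<integral>\<^sup>+u. path_weight t (q j) L \<omega> u *
      of_bool (position L \<omega> u \<in> K \<and> position L \<omega> u \<in> cell j) \<partial>count_space UNIV)" for j \<omega>
  have [measurable]: "V j \<in> borel_measurable P" for j
    unfolding V_def by (intro borel_measurable_nn_integral_count_space) measurable
  have near: "\<nu>.green K (cell j) x \<le> ennreal (g j)" if "x \<in> cell j" "x \<in> K" for j x
  proof -
    have "\<bar>x\<bar> \<le> real j + 1"
      using that(1) by (simp add: cell_def)
    with green that(2) show ?thesis
      by (simp add: g_def)
  qed
  have EV: "(\<integral>\<^sup>+\<omega>. V j \<omega> \<partial>P) \<le> ennreal (2 * g j)" for j
  proof -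
    have "(\<integral>\<^sup>+\<omega>. V j \<omega> \<partial>P) \<le> 2 * \<nu>.green K (cell j) 0"
      unfolding V_def q_def \<nu>_def
      by (rule expected_cell_visits_le[OF law[unfolded \<nu>_def] K g near[unfolded \<nu>_def]])
    also have "\<dots> \<le> 2 * ennreal (g j)"
    proof (rule mult_left_mono)
      show "\<nu>.green K (cell j) 0 \<le> ennreal (g j)"
      proof (cases "0 \<in> K")
        case True
        then show ?thesis
          using green[of 0 j] by (simp add: g_def)
      next
        case False
        then show ?thesis
          by (subst \<nu>.green_outside) auto
      qed
    qed simp
    also have "2 * ennreal (g j) = ennreal (2 * g j)"
      using g[of j] by (simp add: ennreal_mult)
    finally show ?thesis .
  qed
  define Z where "Z \<omega> = (\<Sum>j. ennreal ((1 / 2) ^ j / g j) * V j \<omega>)" for \<omega>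
  have "(\<integral>\<^sup>+\<omega>. Z \<omega> \<partial>P) = (\<Sum>j. ennreal ((1 / 2) ^ j / g j) * (\<integral>\<^sup>+\<omega>. V j \<omega> \<partial>P))"
    unfolding Z_def by (simp add: nn_integral_suminf nn_integral_cmult)
  also have "\<dots> \<le> (\<Sum>j. ennreal (2 * (1 / 2) ^ j))"
  proof (intro suminf_le)
    fix j
    have "ennreal ((1 / 2) ^ j / g j) * (\<integral>\<^sup>+\<omega>. V j \<omega> \<partial>P) \<le> ennreal ((1 / 2) ^ j / g j) * ennreal (2 * g j)"
      by (intro mult_left_mono EV) simp
    also have "\<dots> = ennreal (2 * (1 / 2) ^ j)"
      using g[of j] by (subst ennreal_mult[symmetric]) auto
    finally show "ennreal ((1 / 2) ^ j / g j) * (\<integral>\<^sup>+\<omega>. V j \<omega> \<partial>P) \<le> ennreal (2 * (1 / 2) ^ j)" .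
  qed auto
  also have "\<dots> < \<infinity>"
  proof -
    have "(\<lambda>j. 2 * (1 / 2 :: real) ^ j) sums (2 * (1 / (1 - 1 / 2)))"
      by (intro sums_mult geometric_sums) simp
    then show ?thesis
      by (subst suminf_ennreal_eq) auto
  qed
  finally have "AE \<omega> in P. Z \<omega> \<noteq> \<infinity>"
    by (intro nn_integral_noteq_infinite) (auto simp: Z_def)
  then show ?thesis
  proof eventually_elim
    case (elim \<omega>)
    show ?case
    proof
      assume inK: "\<forall>u\<in>tree L \<omega>. position L \<omega> u \<in> K"
      define z where "z = max 1 (enn2real (Z \<omega>))"
      have "Z \<omega> = ennreal (enn2real (Z \<omega>))"
        using elim by (simp add: less_top)
      also have "\<dots> \<le> ennreal z"
        by (intro ennreal_leI) (simp add: z_def)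
      finally have z: "1 \<le> z" "Z \<omega> \<le> ennreal z"
        by (simp_all add: z_def)
      define B where "B = ln z + ln C + real d + 1 + t"
      have "real (visits_before L \<omega> j u) \<le> 4 * C * B * (1 + real j) ^ Suc d"
        if u: "u \<in> tree L \<omega>" and uj: "position L \<omega> u \<in> cell j" for j u
      proof -
        let ?N = "visits_before L \<omega> j u" and ?y = "1 / (2 * g j)" and ?V = "position L \<omega> u"
        have "(\<Prod>i<length u. q j (position L \<omega> (take i u))) =
            (\<Prod>i<length u. if position L \<omega> (take i u) \<in> cell j then ennreal (1 + ?y) else 1)"
          using inK take_in_tree[OF u] by (intro prod.cong) (auto simp: q_def)
        also have "\<dots> = ennreal (1 + ?y) ^ card {i \<in> {..<length u}. position L \<omega> (take i u) \<in> cell j}"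
          by (subst prod.inter_filter[symmetric]) auto
        also have "{i \<in> {..<length u}. position L \<omega> (take i u) \<in> cell j} =
            {i. i < length u \<and> position L \<omega> (take i u) \<in> cell j}"
          by auto
        also have "ennreal (1 + ?y) ^ card \<dots> = ennreal ((1 + ?y) ^ ?N)"
          unfolding visits_before_def using g[of j] by (subst ennreal_power) auto
        finally have weight: "path_weight t (q j) L \<omega> u = ennreal (exp (- t * ?V)) * ennreal ((1 + ?y) ^ ?N)"
          using u by (simp add: path_weight_def)
        have "ennreal ((1 / 2) ^ j / g j * (exp (- t * ?V) * (1 + ?y) ^ ?N)) =
            ennreal ((1 / 2) ^ j / g j) * path_weight t (q j) L \<omega> u"
          unfolding weight using g[of j]
          by (subst ennreal_mult, simp, simp, subst ennreal_mult) auto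
        also have "\<dots> \<le> ennreal ((1 / 2) ^ j / g j) * V j \<omega>"
        proof (rule mult_left_mono)
          have "path_weight t (q j) L \<omega> u = path_weight t (q j) L \<omega> u * of_bool (?V \<in> K \<and> ?V \<in> cell j)"
            using inK u uj by simp
          also have "\<dots> \<le> V j \<omega>"
            unfolding V_def by (rule nn_integral_ge_point) simp
          finally show "path_weight t (q j) L \<omega> u \<le> V j \<omega>" .
        qed simp
        also have "\<dots> \<le> Z \<omega>"
          unfolding Z_def using sum_le_suminf[of "\<lambda>j. ennreal ((1 / 2) ^ j / g j) * V j \<omega>" "{j}"] by simp
        also have "\<dots> \<le> ennreal z"
          by (rule z)
        finally have "(1 / 2) ^ j / g j * (exp (- t * ?V) * (1 + ?y) ^ ?N) \<le> z"
          using z by (simp add: ennreal_le_iff)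
        then have "(1 + ?y) ^ ?N \<le> z * g j * 2 ^ j * exp (t * ?V)"
          using g[of j] by (simp add: field_simps exp_minus power_one_over)
        moreover have "exp (real ?N * (?y / 2)) \<le> (1 + ?y) ^ ?N"
          using g[of j] by (intro exp_le_power_one_plus) auto
        ultimately have "exp (real ?N * (?y / 2)) \<le> z * g j * 2 ^ j * exp (t * ?V)"
          by linarith
        then have "real ?N * (?y / 2) \<le> ln (z * g j * 2 ^ j * exp (t * ?V))"
          using z g[of j] by (subst ln_ge_iff) auto
        also have "\<dots> = ln z + ln (g j) + real j * ln 2 + t * ?V"
          using z g[of j] by (simp add: ln_mult ln_realpow)
        also have "ln (g j) = ln C + real d * ln (1 + real j)"
          using C by (simp add: g_def ln_mult ln_realpow)
        also have "ln z + (ln C + real d * ln (1 + real j)) + real j * ln 2 + t * ?V \<le> B * (1 + real j)"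
        proof -
          have "ln (1 + real j) \<le> 1 + real j"
            using ln_le_minus_one[of "1 + real j"] by simp
          then have "real d * ln (1 + real j) \<le> real d * (1 + real j)"
            by (rule mult_left_mono) simp
          moreover have "real j * ln 2 \<le> 1 * (1 + real j)"
            using ln_le_minus_one[of 2] mult_left_mono[of "ln 2" 1 "real j"] by simp
          moreover have "t * ?V \<le> t * (1 + real j)"
            using t uj by (intro mult_left_mono) (auto simp: cell_def)
          moreover have "ln z \<le> ln z * (1 + real j)" "ln C \<le> ln C * (1 + real j)"
            using z C by (simp_all add: mult_le_cancel_left1)
          ultimately show ?thesis
            unfolding B_def by (simp only: distrib_right)
        qed
        finally have "real ?N * (?y / 2) \<le> B * (1 + real j)" .
        then have "real ?N \<le> 4 * g j * (B * (1 + real j))"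
          using g[of j] by (simp add: field_simps)
        then show ?thesis
          by (simp add: g_def mult_ac)
      qed
      moreover have "0 \<le> 4 * C * B"
        using z C t by (simp add: B_def)
      ultimately show "\<exists>B\<ge>0. \<forall>j. \<forall>u\<in>tree L \<omega>. position L \<omega> u \<in> cell j \<longrightarrow>
          real (visits_before L \<omega> j u) \<le> B * (1 + real j) ^ Suc d"
        by blast
    qed
  qed
qed

end

section \<open>Sums along rays\<close>

text \<open>Look at the last visit to a cell: all other visits precede it, so a bound on the earlier visits at
each time bounds their total number up to one.\<close>

lemma sum_by_cells_le:
  fixes x :: "nat \<Rightarrow> real" and f F :: "nat \<Rightarrow> ennreal" and c :: "nat \<Rightarrow> real"
  defines "J \<equiv> \<lambda>n. nat \<lfloor>\<bar>x n\<bar>\<rfloor>"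
  assumes f: "\<And>n. n < N \<Longrightarrow> f n \<le> F (J n)"
    and c: "\<And>n. n < N \<Longrightarrow> real (card {i. i < n \<and> x i \<in> cell (J n)}) \<le> c (J n)"
  shows "(\<Sum>n<N. f n) \<le> (\<Sum>j. F j * ennreal (c j + 1))"
proof -
  have count: "real (card {n \<in> {..<N}. J n = j}) \<le> c j + 1" if "j \<in> J ` {..<N}" for j
  proof -
    let ?S = "{n \<in> {..<N}. J n = j}"
    define m where "m = Max ?S"
    have m: "m \<in> ?S"
      unfolding m_def using that by (intro Max_in) auto
    have "?S \<subseteq> insert m {i. i < m \<and> x i \<in> cell (J m)}"
    proof
      fix n assume n: "n \<in> ?S"
      then have "n \<le> m"
        unfolding m_def by (intro Max_ge) auto
      have "J n = J m"
        using n m by simp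
      then have "x n \<in> cell (J m)"
        unfolding in_cell_iff J_def .
      with \<open>n \<le> m\<close> show "n \<in> insert m {i. i < m \<and> x i \<in> cell (J m)}"
        by (cases "n = m") auto
    qed
    then have "card ?S \<le> card (insert m {i. i < m \<and> x i \<in> cell (J m)})"
      by (intro card_mono) auto
    also have "\<dots> \<le> card {i. i < m \<and> x i \<in> cell (J m)} + 1"
      by (simp add: card_insert_if)
    finally show ?thesis
      using c[of m] m by simp
  qed
  have "(\<Sum>n<N. f n) \<le> (\<Sum>n<N. F (J n))"
    using f by (intro sum_mono) auto
  also have "\<dots> = (\<Sum>j\<in>J ` {..<N}. \<Sum>n\<in>{n \<in> {..<N}. J n = j}. F (J n))"
    by (rule sum.image_gen) simp
  also have "\<dots> = (\<Sum>j\<in>J ` {..<N}. F j * ennreal (real (card {n \<in> {..<N}. J n = j})))"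
    by (intro sum.cong) (auto simp: ennreal_of_nat_eq_real_of_nat mult.commute)
  also have "\<dots> \<le> (\<Sum>j\<in>J ` {..<N}. F j * ennreal (c j + 1))"
    by (intro sum_mono mult_left_mono ennreal_leI count) auto
  also have "\<dots> \<le> (\<Sum>j. F j * ennreal (c j + 1))"
    by (intro sum_le_suminf) auto
  finally show ?thesis .
qed

lemma take_child_chain:
  assumes "\<xi> 0 = []" "\<And>n. Suc n < N \<Longrightarrow> is_child (\<xi> n) (\<xi> (Suc n))" "n < N"
  shows "length (\<xi> n) = n \<and> (\<forall>i\<le>n. take i (\<xi> n) = \<xi> i)"
  using assms(3)
proof (induction n)
  case (Suc n)
  then obtain k where "\<xi> (Suc n) = \<xi> n @ [k]"
    using assms(2) by (auto simp: is_child_def)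
  with Suc show ?case
    by (auto simp: le_Suc_eq)
qed (use assms in auto)

lemma ray_sum_le_cells:
  fixes c :: "nat \<Rightarrow> real" and F :: "nat \<Rightarrow> ennreal"
  assumes visits: "\<And>j u. u \<in> tree L \<omega> \<Longrightarrow> position L \<omega> u \<in> cell j \<Longrightarrow> real (visits_before L \<omega> j u) \<le> c j"
    and f: "\<And>u. u \<in> tree L \<omega> \<Longrightarrow> f u \<le> F (nat \<lfloor>\<bar>position L \<omega> u\<bar>\<rfloor>)"
    and \<xi>: "\<xi> \<in> rays (tree L \<omega>)"
  shows "ray_sum f \<xi> \<le> (\<Sum>j. F j * ennreal (c j + 1))"
proof -
  have chain: "(\<Sum>n<N. f (x n)) \<le> (\<Sum>j. F j * ennreal (c j + 1))"
    if root: "x 0 = []" and child: "\<And>n. Suc n < N \<Longrightarrow> is_child (x n) (x (Suc n))"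
      and in_tree: "\<And>n. n < N \<Longrightarrow> x n \<in> tree L \<omega>" for x :: "nat \<Rightarrow> nat list" and N
  proof (rule sum_by_cells_le[where x = "\<lambda>n. position L \<omega> (x n)"])
    fix n assume n: "n < N"
    let ?j = "nat \<lfloor>\<bar>position L \<omega> (x n)\<bar>\<rfloor>"
    show "f (x n) \<le> F ?j"
      using f in_tree n by simp
    have tk: "length (x n) = n" "\<forall>i\<le>n. take i (x n) = x i"
      using take_child_chain[OF root child n] by auto
    have "{i. i < n \<and> position L \<omega> (x i) \<in> cell ?j} = {i. i < length (x n) \<and> position L \<omega> (take i (x n)) \<in> cell ?j}"
      using tk by auto
    then have "card {i. i < n \<and> position L \<omega> (x i) \<in> cell ?j} = visits_before L \<omega> ?j (x n)"
      by (simp add: visits_before_def)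
    then show "real (card {i. i < n \<and> position L \<omega> (x i) \<in> cell ?j}) \<le> c ?j"
      using visits[OF in_tree[OF n], of ?j] by (simp add: in_cell_iff)
  qed
  show ?thesis
  proof (cases \<xi>)
    case (Finite_Ray us)
    have "ray_sum f \<xi> = (\<Sum>n<length us. f (us ! n))"
      by (simp add: Finite_Ray sum_list_sum_nth atLeast0LessThan)
    also have "\<dots> \<le> (\<Sum>j. F j * ennreal (c j + 1))"
      using \<xi> by (intro chain) (auto simp: Finite_Ray rays_def hd_conv_nth)
    finally show ?thesis .
  next
    case (Infinite_Ray x)
    have "(\<Sum>n. f (x n)) \<le> (\<Sum>j. F j * ennreal (c j + 1))"
      using \<xi> by (intro suminf_le_const chain) (auto simp: Infinite_Ray rays_def)
    then show ?thesis
      by (simp add: Infinite_Ray)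
  qed
qed

text \<open>With \<open>O(j ^ (d + 1))\<close> visits to cell \<open>j\<close>, a summand of order \<open>j powr (- b)\<close> there leads to the series
of \<open>j powr (d + 1 - b)\<close>, which converges for \<open>b > d + 2\<close>.\<close>

lemma SUP_ray_sum_finite:
  fixes a b B :: real and d :: nat
  assumes B: "0 \<le> B"
    and visits: "\<And>j u. u \<in> tree L \<omega> \<Longrightarrow> position L \<omega> u \<in> cell j \<Longrightarrow>
      real (visits_before L \<omega> j u) \<le> B * (1 + real j) ^ Suc d"
    and a: "0 \<le> a" and b: "real d + 2 < b"
    and f: "\<And>u. u \<in> tree L \<omega> \<Longrightarrow> f u \<le> ennreal (a * (1 + \<bar>position L \<omega> u\<bar>) powr (- b))"
  shows "(SUP \<xi>\<in>rays (tree L \<omega>). ray_sum f \<xi>) < \<infinity>"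
proof -
  define F where "F j = ennreal (a * (1 + real j) powr (- b))" for j
  have "(SUP \<xi>\<in>rays (tree L \<omega>). ray_sum f \<xi>) \<le> (\<Sum>j. F j * ennreal (B * (1 + real j) ^ Suc d + 1))"
  proof (intro SUP_least ray_sum_le_cells[OF visits])
    fix u assume u: "u \<in> tree L \<omega>"
    let ?j = "nat \<lfloor>\<bar>position L \<omega> u\<bar>\<rfloor>"
    have "(1 + \<bar>position L \<omega> u\<bar>) powr (- b) \<le> (1 + real ?j) powr (- b)"
    proof (rule powr_mono2')
      show "0 < 1 + real ?j"
        by (rule add_pos_nonneg) simp_all
      show "1 + real ?j \<le> 1 + \<bar>position L \<omega> u\<bar>"
        by (intro add_left_mono of_nat_floor) simp
    qed (use b in simp)
    then have "a * (1 + \<bar>position L \<omega> u\<bar>) powr (- b) \<le> a * (1 + real ?j) powr (- b)"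
      using a by (rule mult_left_mono)
    with f[OF u] show "f u \<le> F ?j"
      unfolding F_def by (meson ennreal_leI order_trans)
  qed
  also have "\<dots> \<le> (\<Sum>j. ennreal (a * (B + 1) * real (Suc j) powr (real (Suc d) - b)))"
  proof (intro suminf_le)
    fix j
    have "B * (1 + real j) ^ Suc d + 1 \<le> (B + 1) * (1 + real j) ^ Suc d"
      by (simp add: distrib_right del: power_Suc)
    then have "a * (1 + real j) powr (- b) * (B * (1 + real j) ^ Suc d + 1) \<le>
        a * (1 + real j) powr (- b) * ((B + 1) * (1 + real j) ^ Suc d)"
      using a by (intro mult_left_mono) auto
    also have "\<dots> = a * (B + 1) * real (Suc j) powr (real (Suc d) - b)"
    proof -
      have "(1 + real j) ^ Suc d = (1 + real j) powr real (Suc d)"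
        by (rule powr_realpow[symmetric]) simp
      then show ?thesis
        by (simp add: powr_diff powr_minus field_simps del: power_Suc)
    qed
    finally show "F j * ennreal (B * (1 + real j) ^ Suc d + 1) \<le>
        ennreal (a * (B + 1) * real (Suc j) powr (real (Suc d) - b))"
      unfolding F_def using a B by (subst ennreal_mult[symmetric]) (auto intro!: ennreal_leI)
  qed auto
  also have "\<dots> < \<infinity>"
  proof -
    have "summable (\<lambda>j. real j powr (real (Suc d) - b))"
      using b by (subst summable_real_powr_iff) auto
    then have "summable (\<lambda>j. a * (B + 1) * real (Suc j) powr (real (Suc d) - b))"
      by (intro summable_mult) (subst summable_Suc_iff)
    then show ?thesis
      using a B by (subst suminf_ennreal_eq[OF _ summable_sums]) auto
  qed
  finally show ?thesis .
qed

text \<open>Any polynomial rate above \<open>3\<close> serves to compare the exponential ray sums with the polynomial ones;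
the constant comes from \<open>(1 + x / 4) ^ 4 \<le> exp x\<close> and \<open>1 + x \<le> 4 * (1 + x / 4)\<close>.\<close>

lemma exp_minus_le_powr_minus_4:
  fixes x :: real
  assumes "0 \<le> x"
  shows "exp (- x) \<le> 256 * (1 + x) powr (- 4)"
proof -
  have "(1 + x / 4) ^ 4 \<le> exp x"
    using exp_ge_one_plus_x_over_n_power_n[of 4 x] assms by simp
  have "(1 + x) ^ 4 \<le> (4 * (1 + x / 4)) ^ 4"
    using assms by (intro power_mono) auto
  also have "\<dots> = 256 * (1 + x / 4) ^ 4"
    by (simp only: power_mult_distrib) simp
  also have "\<dots> \<le> 256 * exp x"
    using \<open>(1 + x / 4) ^ 4 \<le> exp x\<close> by (rule mult_left_mono) simp
  finally have "(1 + x) ^ 4 \<le> 256 * exp x" .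
  then have "exp (- x) * (1 + x) ^ 4 \<le> exp (- x) * (256 * exp x)"
    by (rule mult_left_mono) simp
  also have "\<dots> = 256"
    by (simp add: exp_minus)
  finally have "exp (- x) \<le> 256 / (1 + x) ^ 4"
    using assms by (subst pos_le_divide_eq) auto
  moreover have "(1 + x) powr (- 4) = 1 / (1 + x) ^ 4"
    using assms by (simp add: powr_minus_divide powr_numeral)
  ultimately show ?thesis
    by simp
qed

text \<open>The mean may be infinite, and the Wald argument needs bounded overshoots; monotone convergence shows
that a truncation from above at a high level still has positive mean.\<close>

lemma truncation_has_positive_mean:
  assumes "finite_measure M" and f [measurable]: "f \<in> borel_measurable M"
    and less: "(\<integral>\<^sup>+x. ennreal (- f x) \<partial>M) < (\<integral>\<^sup>+x. ennreal (f x) \<partial>M)"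
  shows "\<exists>c. integrable M (\<lambda>x. min (f x) c) \<and> 0 < (\<integral>x. min (f x) c \<partial>M)"
proof -
  interpret finite_measure M by fact
  have sup: "(SUP n. ennreal (min y (real n))) = ennreal y" for y
  proof (rule antisym)
    obtain n where "y \<le> real n"
      using real_arch_simple by blast
    then show "ennreal y \<le> (SUP n. ennreal (min y (real n)))"
      by (intro SUP_upper2[of n]) (auto simp: min_def)
  qed (auto intro!: SUP_least ennreal_leI)
  have "(\<integral>\<^sup>+x. ennreal (f x) \<partial>M) = (\<integral>\<^sup>+x. (SUP n. ennreal (min (f x) (real n))) \<partial>M)"
    by (simp only: sup)
  also have "\<dots> = (SUP n. \<integral>\<^sup>+x. ennreal (min (f x) (real n)) \<partial>M)"
    by (rule nn_integral_monotone_convergence_SUP)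
      (auto simp: incseq_def le_fun_def intro!: ennreal_leI min.mono)
  finally obtain n where n: "(\<integral>\<^sup>+x. ennreal (- f x) \<partial>M) < (\<integral>\<^sup>+x. ennreal (min (f x) (real n)) \<partial>M)"
    using less by (auto simp: less_SUP_iff)
  have neg: "(\<integral>\<^sup>+x. ennreal (- min (f x) (real n)) \<partial>M) = (\<integral>\<^sup>+x. ennreal (- f x) \<partial>M)"
    by (intro nn_integral_cong) (auto simp: min_def ennreal_neg)
  have neg_fin: "(\<integral>\<^sup>+x. ennreal (- f x) \<partial>M) < \<infinity>"
    using less by (rule less_le_trans) simp
  have pos_fin: "(\<integral>\<^sup>+x. ennreal (min (f x) (real n)) \<partial>M) < \<infinity>"
  proof -
    have "(\<integral>\<^sup>+x. ennreal (min (f x) (real n)) \<partial>M) \<le> (\<integral>\<^sup>+x. ennreal (real n) \<partial>M)"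
      by (intro nn_integral_mono ennreal_leI) simp
    also have "\<dots> < \<infinity>"
      by (simp add: emeasure_eq_measure ennreal_mult[symmetric])
    finally show ?thesis .
  qed
  have int: "integrable M (\<lambda>x. min (f x) (real n))"
    using neg_fin pos_fin neg by (auto simp: real_integrable_def)
  have "0 < (\<integral>x. min (f x) (real n) \<partial>M)"
    unfolding real_lebesgue_integral_def[OF int] neg
    using n pos_fin by (simp add: enn2real_less_iff ennreal_enn2real_if)
  with int show ?thesis by blast
qed

section \<open>The tilted law under the two hypotheses\<close>

lemma phi_eq_0_imp:
  assumes "phi \<mu> t = 0"
  shows "(\<integral>\<^sup>+x. ennreal (exp (- t * x)) \<partial>\<mu>) = 1"
proof -
  let ?I = "\<integral>\<^sup>+x. ennreal (exp (- t * x)) \<partial>\<mu>"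
  have "?I \<noteq> 0" "?I \<noteq> \<top>" and ln: "ln (enn2real ?I) = 0"
    using assms by (auto simp: phi_def ln_ennreal_def zero_ereal_def split: if_splits)
  then have "0 < enn2real ?I"
    by (simp add: enn2real_positive_iff less_top zero_less_iff_neq_zero)
  with ln have "enn2real ?I = 1"
    by simp
  then have "ennreal (enn2real ?I) = 1"
    by simp
  with \<open>?I \<noteq> \<top>\<close> show ?thesis
    by (simp add: less_top)
qed

context
  fixes \<mu> :: "real measure" and t :: real
  assumes sets_\<mu> [measurable_cong]: "sets \<mu> = sets borel" and phi: "phi \<mu> t = 0"
begin

lemma step_law_tilt: "step_law (tilted_law \<mu> t)"
proof -
  have "emeasure (tilted_law \<mu> t) (space (tilted_law \<mu> t)) = (\<integral>\<^sup>+x. ennreal (exp (- t * x)) \<partial>\<mu>)"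
    by (subst emeasure_density) (auto intro!: nn_integral_cong)
  then have "prob_space (tilted_law \<mu> t)"
    using phi_eq_0_imp[OF phi] by (intro prob_spaceI) simp
  then show ?thesis
    by (auto simp: step_law_def step_law_axioms_def sets_\<mu>)
qed

lemma tilted_pos_eq: "tilted_pos \<mu> t = (\<integral>\<^sup>+x. ennreal x \<partial>tilted_law \<mu> t)"
  unfolding tilted_pos_def
  by (subst nn_integral_density)
    (auto intro!: nn_integral_cong simp: ennreal_mult'[symmetric] mult.commute indicator_def ennreal_neg mult_nonpos_nonneg)

lemma tilted_neg_eq: "tilted_neg \<mu> t = (\<integral>\<^sup>+x. ennreal (- x) \<partial>tilted_law \<mu> t)"
  unfolding tilted_neg_def
  by (subst nn_integral_density)
    (auto intro!: nn_integral_cong simp: ennreal_mult'[symmetric] mult.commute indicator_def ennreal_neg mult_nonpos_nonneg)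

lemma tilted_second_moment_eq: "tilted_second_moment \<mu> t = (\<integral>\<^sup>+x. ennreal (x\<^sup>2) \<partial>tilted_law \<mu> t)"
  unfolding tilted_second_moment_def
  by (subst nn_integral_density)
    (auto intro!: nn_integral_cong simp: ennreal_mult'[symmetric] mult.commute)

lemma nonzero_mean_imp_truncated_drift:
  assumes "tilted_mean_well_defined \<mu> t" "tilted_mean \<mu> t \<noteq> 0"
  shows "\<exists>c M. \<bar>c\<bar> = 1 \<and> integrable (tilted_law \<mu> t) (\<lambda>y. min (c * y) M) \<and> 0 < (\<integral>y. min (c * y) M \<partial>tilted_law \<mu> t)"
proof -
  interpret step_law "tilted_law \<mu> t"
    by (rule step_law_tilt)
  have fin: "finite_measure (tilted_law \<mu> t)"
    by (rule prob_space.finite_measure[OF prob_space_step])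
  have "tilted_pos \<mu> t \<noteq> tilted_neg \<mu> t"
  proof
    assume eq: "tilted_pos \<mu> t = tilted_neg \<mu> t"
    with assms(1) have "\<bar>enn2ereal (tilted_neg \<mu> t)\<bar> \<noteq> \<infinity>"
      by (cases "tilted_neg \<mu> t") (auto simp: tilted_mean_well_defined_def)
    with eq assms(2) show False
      by (simp add: tilted_mean_def)
  qed
  then consider "tilted_neg \<mu> t < tilted_pos \<mu> t" | "tilted_pos \<mu> t < tilted_neg \<mu> t"
    by (meson linorder_neqE)
  then show ?thesis
  proof cases
    case 1
    have "\<exists>M. integrable (tilted_law \<mu> t) (\<lambda>y. min (1 * y) M) \<and> 0 < (\<integral>y. min (1 * y) M \<partial>tilted_law \<mu> t)"
      by (rule truncation_has_positive_mean[OF fin]) (use 1 in \<open>simp_all add: tilted_pos_eq tilted_neg_eq\<close>)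
    then show ?thesis
      by - (rule exI[of _ "1 :: real"], simp)
  next
    case 2
    have "\<exists>M. integrable (tilted_law \<mu> t) (\<lambda>y. min (- 1 * y) M) \<and> 0 < (\<integral>y. min (- 1 * y) M \<partial>tilted_law \<mu> t)"
      by (rule truncation_has_positive_mean[OF fin]) (use 2 in \<open>simp_all add: tilted_pos_eq tilted_neg_eq\<close>)
    then show ?thesis
      by - (rule exI[of _ "- 1 :: real"], simp)
  qed
qed

text \<open>The positive and negative parts of the tilted law have equal first moments,
and these cannot both vanish because the second moment is positive.\<close>

lemma zero_mean_imp_two_sided:
  assumes "tilted_mean_well_defined \<mu> t" "tilted_mean \<mu> t = 0" "0 < tilted_second_moment \<mu> t"
  shows "0 < emeasure (tilted_law \<mu> t) {y. 0 < y}" "0 < emeasure (tilted_law \<mu> t) {y. y < 0}"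
proof -
  have eq: "tilted_pos \<mu> t = tilted_neg \<mu> t"
    using assms(1,2) unfolding tilted_mean_well_defined_def tilted_mean_def
    by (cases "tilted_pos \<mu> t"; cases "tilted_neg \<mu> t") (auto simp: enn2ereal_ennreal)
  have [measurable]: "{y::real. 0 < y} \<in> sets borel" "{y::real. y < 0} \<in> sets borel"
    by measurable
  have up: "AE y in tilted_law \<mu> t. \<not> 0 < y" if "emeasure (tilted_law \<mu> t) {y. 0 < y} = 0"
    using that by (subst AE_iff_measurable[of "{y. 0 < y}"]) (auto simp: sets_\<mu> sets_eq_imp_space_eq[OF sets_\<mu>])
  have down: "AE y in tilted_law \<mu> t. \<not> y < 0" if "emeasure (tilted_law \<mu> t) {y. y < 0} = 0"
    using that by (subst AE_iff_measurable[of "{y. y < 0}"]) (auto simp: sets_\<mu> sets_eq_imp_space_eq[OF sets_\<mu>])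
  have pos_0: "tilted_pos \<mu> t = 0 \<longleftrightarrow> (AE y in tilted_law \<mu> t. \<not> 0 < y)"
    unfolding tilted_pos_eq by (subst nn_integral_0_iff_AE) (auto simp: ennreal_eq_0_iff not_less)
  have neg_0: "tilted_neg \<mu> t = 0 \<longleftrightarrow> (AE y in tilted_law \<mu> t. \<not> y < 0)"
    unfolding tilted_neg_eq by (subst nn_integral_0_iff_AE) (auto simp: ennreal_eq_0_iff not_less)
  have "tilted_pos \<mu> t \<noteq> 0"
  proof
    assume "tilted_pos \<mu> t = 0"
    then have "AE y in tilted_law \<mu> t. \<not> 0 < y" "AE y in tilted_law \<mu> t. \<not> y < 0"
      using pos_0 neg_0 eq by auto
    then have "AE y in tilted_law \<mu> t. ennreal (y\<^sup>2) = 0"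
      by eventually_elim (auto simp: not_less antisym)
    then have "tilted_second_moment \<mu> t = 0"
      unfolding tilted_second_moment_eq by (subst nn_integral_0_iff_AE) auto
    with assms(3) show False by simp
  qed
  with pos_0 neg_0 eq up down show "0 < emeasure (tilted_law \<mu> t) {y. 0 < y}" "0 < emeasure (tilted_law \<mu> t) {y. y < 0}"
    by (auto simp: zero_less_iff_neq_zero)
qed

end

context branching_random_walk
begin

text \<open>The exponent \<open>d\<close> is the growth rate of the Green function over the cells. Positions are bounded below
by a random level, and on the event that this level is \<open>-A\<close> killing outside a set that contains
\<open>[-A, \<infinity>)\<close> removes no particle. For negative positions \<open>V \<ge> -A\<close> the bound
\<open>exp (- V) \<le> exp (2 * A) * exp (- \<bar>V\<bar>)\<close> reduces the exponential sums to the polynomial ones with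
exponent \<open>4\<close>, which exceeds \<open>d + 2\<close>.\<close>

lemma ray_sums_finite:
  fixes t :: real and d :: nat
  assumes t: "t > 0" and phi: "phi (intensity P L) t = 0"
    and green: "\<And>A::nat. \<exists>K C. K \<in> sets borel \<and> {- real A..} \<subseteq> K \<and> 1 \<le> C \<and>
      (\<forall>j x. x \<in> K \<longrightarrow> \<bar>x\<bar> \<le> real j + 1 \<longrightarrow>
        step_law.green (tilted_law (intensity P L) t) K (cell j) x \<le> ennreal (C * (1 + real j) ^ d))"
    and d: "d \<le> 1"
  shows "AE \<omega> in P. M_sup L \<omega> < \<infinity> \<and> (\<forall>b>real d + 2. Xi_sup L b \<omega> < \<infinity>)"
proof -
  have law: "step_law (tilted_law (intensity P L) t)"
    using phi by (intro step_law_tilt) auto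
  have "AE \<omega> in P. (\<forall>u\<in>tree L \<omega>. - real A \<le> position L \<omega> u) \<longrightarrow>
    (\<exists>B\<ge>0. \<forall>j. \<forall>u\<in>tree L \<omega>. position L \<omega> u \<in> cell j \<longrightarrow>
      real (visits_before L \<omega> j u) \<le> B * (1 + real j) ^ Suc d)" for A :: nat
  proof -
    from green[of A] obtain K C where K: "K \<in> sets borel" "{- real A..} \<subseteq> K" "1 \<le> C"
      and G: "\<And>j x. x \<in> K \<Longrightarrow> \<bar>x\<bar> \<le> real j + 1 \<Longrightarrow>
        step_law.green (tilted_law (intensity P L) t) K (cell j) x \<le> ennreal (C * (1 + real j) ^ d)"
      by blast
    have "AE \<omega> in P. (\<forall>u\<in>tree L \<omega>. position L \<omega> u \<in> K) \<longrightarrow>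
      (\<exists>B\<ge>0. \<forall>j. \<forall>u\<in>tree L \<omega>. position L \<omega> u \<in> cell j \<longrightarrow>
        real (visits_before L \<omega> j u) \<le> B * (1 + real j) ^ Suc d)"
      by (rule AE_visits_polynomial[OF t law K(1,3)]) (rule G)
    then show ?thesis
    proof eventually_elim
      case (elim \<omega>)
      with K(2) show ?case by blast
    qed
  qed
  then have "AE \<omega> in P. \<forall>A::nat. (\<forall>u\<in>tree L \<omega>. - real A \<le> position L \<omega> u) \<longrightarrow>
    (\<exists>B\<ge>0. \<forall>j. \<forall>u\<in>tree L \<omega>. position L \<omega> u \<in> cell j \<longrightarrow>
      real (visits_before L \<omega> j u) \<le> B * (1 + real j) ^ Suc d)"
    by (intro AE_all_countable[THEN iffD2] allI)
  with AE_positions_bounded_below[OF t law] show ?thesis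
  proof eventually_elim
    case (elim \<omega>)
    from elim(1) obtain A :: nat where A: "\<And>u. u \<in> tree L \<omega> \<Longrightarrow> - real A \<le> position L \<omega> u"
      by blast
    then have "\<forall>u\<in>tree L \<omega>. - real A \<le> position L \<omega> u"
      by blast
    with elim(2) obtain B where B: "0 \<le> B"
      and visits: "\<And>j u. u \<in> tree L \<omega> \<Longrightarrow> position L \<omega> u \<in> cell j \<Longrightarrow>
        real (visits_before L \<omega> j u) \<le> B * (1 + real j) ^ Suc d"
      by blast
    have "Xi_sup L b \<omega> < \<infinity>" if "b > real d + 2" for b
      unfolding Xi_sup_def using that
      by (intro SUP_ray_sum_finite[OF B visits, where a = 1 and b = b]) auto
    moreover have "M_sup L \<omega> < \<infinity>"
      unfolding M_sup_def
    proof (rule SUP_ray_sum_finite[OF B visits, where a = "exp (2 * real A) * 256" and b = 4])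
      fix u assume u: "u \<in> tree L \<omega>"
      let ?V = "position L \<omega> u"
      have "exp (- ?V) \<le> exp (2 * real A) * exp (- \<bar>?V\<bar>)"
        using A[OF u] by (simp add: exp_add[symmetric])
      also have "\<dots> \<le> exp (2 * real A) * (256 * (1 + \<bar>?V\<bar>) powr (- 4))"
        by (intro mult_left_mono exp_minus_le_powr_minus_4) auto
      finally show "ennreal (exp (- ?V)) \<le> ennreal (exp (2 * real A) * 256 * (1 + \<bar>?V\<bar>) powr - 4)"
        by (simp add: mult.assoc ennreal_leI)
    qed (use d in auto)
    ultimately show ?case by blast
  qed
qed

lemma AE_P_starI: "AE \<omega> in P. Q \<omega> \<Longrightarrow> AE \<omega> in P_star P L. Q \<omega>"
  unfolding P_star_def by (rule AE_uniform_measureI[OF sets_survival]) auto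

text \<open>A nonzero tilted mean makes the walk transient, so its Green function is bounded and \<open>d = 0\<close>.\<close>

theorem H1_ray_sums_finite:
  assumes "H1 (intensity P L)"
  shows "AE \<omega> in P. M_sup L \<omega> < \<infinity> \<and> (\<forall>b>2. Xi_sup L b \<omega> < \<infinity>)"
proof -
  obtain t where t: "t > 0" and phi: "phi (intensity P L) t = 0"
    and mean: "tilted_mean_well_defined (intensity P L) t" "tilted_mean (intensity P L) t \<noteq> 0"
    using assms by (auto simp: H1_def)
  interpret W: step_law "tilted_law (intensity P L) t"
    using phi by (intro step_law_tilt) auto
  obtain c M where "\<bar>c\<bar> = 1"
    "integrable (tilted_law (intensity P L) t) (\<lambda>y. min (c * y) M)"
    "0 < (\<integral>y. min (c * y) M \<partial>tilted_law (intensity P L) t)"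
    using nonzero_mean_imp_truncated_drift[OF sets_intensity phi mean] by blast
  then obtain C where C: "1 \<le> C" "\<And>j x. W.green UNIV (cell j) x \<le> ennreal C"
    using W.green_cell_drift_bounded by blast
  have "\<exists>K C. K \<in> sets borel \<and> {- real A..} \<subseteq> K \<and> 1 \<le> C \<and>
      (\<forall>j x. x \<in> K \<longrightarrow> \<bar>x\<bar> \<le> real j + 1 \<longrightarrow> W.green K (cell j) x \<le> ennreal (C * (1 + real j) ^ 0))" for A :: nat
    using C by (intro exI[of _ UNIV] exI[of _ C]) auto
  from ray_sums_finite[OF t phi this] show ?thesis
    by simp
qed

text \<open>A centred walk that is killed below \<open>-A\<close> has a Green function of linear growth, so \<open>d = 1\<close>.\<close>

theorem H2_ray_sums_finite:
  assumes "H2 (intensity P L)"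
  shows "AE \<omega> in P. M_sup L \<omega> < \<infinity> \<and> (\<forall>b>3. Xi_sup L b \<omega> < \<infinity>)"
proof -
  obtain t where t: "t > 0" and phi: "phi (intensity P L) t = 0"
    and mean: "tilted_mean_well_defined (intensity P L) t" "tilted_mean (intensity P L) t = 0"
      "0 < tilted_second_moment (intensity P L) t"
    using assms by (auto simp: H2_def)
  interpret W: step_law "tilted_law (intensity P L) t"
    using phi by (intro step_law_tilt) auto
  note two_sided = zero_mean_imp_two_sided[OF sets_intensity phi mean]
  have "\<exists>K C. K \<in> sets borel \<and> {- real A..} \<subseteq> K \<and> 1 \<le> C \<and>
      (\<forall>j x. x \<in> K \<longrightarrow> \<bar>x\<bar> \<le> real j + 1 \<longrightarrow> W.green K (cell j) x \<le> ennreal (C * (1 + real j) ^ 1))" for A :: nat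
  proof -
    obtain C where "1 \<le> C" "\<forall>j x. - real A \<le> x \<longrightarrow> \<bar>x\<bar> \<le> real j + 1 \<longrightarrow>
        W.green {- real A..} (cell j) x \<le> ennreal (C * (1 + real j))"
      using W.green_cell_half_line_linear_growth[OF two_sided, of "- real A"] by auto
    then show ?thesis
      by (intro exI[of _ "{- real A..}"] exI[of _ C]) auto
  qed
  from ray_sums_finite[OF t phi this] show ?thesis
    by simp
qed

end

theorem theorem1p1:
  fixes P :: "'a measure" and L :: "nat list \<Rightarrow> 'a \<Rightarrow> config"
  assumes "branching_random_walk P L"
    and "emeasure (intensity P L) UNIV > 1"
    and "H1 (intensity P L) \<or> H2 (intensity P L)"
  shows "(AE \<omega> in P_star P L. M_sup L \<omega> < \<infinity>) \<and>
    (H1 (intensity P L) \<longrightarrow> (AE \<omega> in P_star P L. \<forall>b>2. Xi_sup L b \<omega> < \<infinity>)) \<and>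
    (H2 (intensity P L) \<longrightarrow> (AE \<omega> in P_star P L. \<forall>b>3. Xi_sup L b \<omega> < \<infinity>))"
proof -
  interpret branching_random_walk P L
    by fact
  have "AE \<omega> in P_star P L. M_sup L \<omega> < \<infinity> \<and> (\<forall>b>2. Xi_sup L b \<omega> < \<infinity>)" if "H1 (intensity P L)"
    by (rule AE_P_starI[OF H1_ray_sums_finite[OF that]])
  moreover have "AE \<omega> in P_star P L. M_sup L \<omega> < \<infinity> \<and> (\<forall>b>3. Xi_sup L b \<omega> < \<infinity>)" if "H2 (intensity P L)"
    by (rule AE_P_starI[OF H2_ray_sums_finite[OF that]])
  ultimately show ?thesis
    using assms(3) by auto
qed

end
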